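(* Let $\mathbb{T}=(T,\eta,(-)^* )$ be a monad on a category $\mathbf{C}$ with finite coproducts and let $X\#Y=T(X+Y)$. (i) If $\mathbb{T}$ equipped with an operator $(-)^\dagger$ is a weak complete Elgot monad, then $\mathbf{C}^{\mathbb{T}}$ is isomorphic to the full subcategory of $\mathbf{CElg}_\#(\mathbf{C})$ formed by those complete Elgot $\#$-algebras $(A,a:T(A+A)\to A,(-)^\ddagger)$ for which $a$ factors through $T\nabla:T(A+A)\to TA$ and for which $e^\ddagger=a\circ T\mathsf{inl}\circ e^\dagger$ for every $e:X\to T(A+X)$. (ii) Conversely, suppose $J:\mathbf{C}^{\mathbb{T}}\to\mathbf{CElg}_\#(\mathbf{C})$ is a functor that sends each $\mathbb{T}$-algebra $a:TA\to A$ to a complete Elgot $\#$-algebra whose carrier is $A$ and whose $\#$-algebra structure is $a\circ T\nabla:T(A+A)\to A$, and is the identity on morphisms. Then $\mathbb{T}$ becomes a weak complete Elgot monad with the operator defined for $e:X\to T(Y+X)$ by \[e^\dagger=(T(\eta_Y+\mathrm{id}_X)\circ e)^\ddagger:X\to TY,\] where $(-)^\ddagger$ is the iteration operator of $J(TY,\mu_Y)$; moreover $J$ is then full and faithful.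
   Context: Monads are Kleisli triples with $Tf=(\eta\circ f)^*$, $\mu=\mathrm{id}^*$; $\nabla=[\mathrm{id},\mathrm{id}]$. $\mathbf{C}^{\mathbb{T}}$ is the category of Eilenberg–Moore $\mathbb{T}$-algebras. The parametrized monad $X\#Y=T(X+Y)$ has unit $u^Y_X=\eta\circ\mathsf{inl}$ and multiplication $m^Y_X=[\mathrm{id},\eta\circ\mathsf{inr}]^*:T(T(X+Y)+Y)\to T(X+Y)$. A $\#$-algebra is $(A,a)$, $a:A\#A\to A$, with $a\circ u^A_A=\mathrm{id}$, $a\circ(a\#\mathrm{id})=a\circ m^A_A$. A complete Elgot $\#$-algebra is a $\#$-algebra $(A,a)$ with an operator sending each $e:X\to A\#X$ to $e^\ddagger:X\to A$ such that: (solution) $e^\ddagger=a\circ(\mathrm{id}_A\#e^\ddagger)\circ e$; (functoriality) for $e:X\to A\#X$, $f:Y\to A\#Y$, $h:X\to Y$, if $f\circ h=(\mathrm{id}_A\#h)\circ e$ then $f^\ddagger\circ h=e^\ddagger$; (compositionality) for $f:Y\to A\#Y$, $g:X\to Y\#X$, with $f^\ddagger\bullet g=(f^\ddagger\#\mathrm{id}_X)\circ g$ and $f\blacksquare g=m^{Y+X}_A\circ(((\mathrm{id}_A\#\mathsf{inl})\circ f)\#\mathsf{inr})\circ[u^X_Y,g]$, $(f\blacksquare g)^\ddagger\circ\mathsf{inr}=(f^\ddagger\bullet g)^\ddagger$. $\mathbf{CElg}_\#(\mathbf{C})$ has as morphisms $(A,a,\ddagger)\to(B,b,\ddagger')$ those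 $f:A\to B$ with $((f\#\mathrm{id})\circ e)^{\ddagger'}=f\circ e^\ddagger$ for all $e$. A weak complete Elgot monad is a monad with an operator sending $f:X\to T(Y+X)$ to $f^\dagger:X\to TY$ satisfying: (fixpoint) $f^\dagger=[\eta_Y,f^\dagger]^*\circ f$; (naturality) for $g:Y\to TZ$, $g^*\circ f^\dagger=([T\mathsf{inl}\circ g,\eta\circ\mathsf{inr}]^*\circ f)^\dagger$; (uniformity) if $f\circ h=T(\mathrm{id}_Y+h)\circ g$ for $g:Z\to T(Y+Z)$, $h:Z\to X$, then $f^\dagger\circ h=g^\dagger$; and for all $g:X\to T(Y+X)$, $f:Y\to T(Z+Y)$, with $w=[T(\mathrm{id}_Z+\mathsf{inl})\circ f,\eta\circ\mathsf{inr}\circ\mathsf{inr}]^*\circ[\eta\circ\mathsf{inl},g]:Y+X\to T(Z+(Y+X))$, one has $w^\dagger\circ\mathsf{inr}=(f^\dagger)^*\circ g^\dagger$. *)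

theory Defs
  imports Main "HOL-Library.FuncSet"
begin

section \<open>Categories and functors\<close>

record ('o, 'm) cat =
  Obj :: "'o set"
  Arr :: "'m set"
  Dom :: "'m \<Rightarrow> 'o"
  Cod :: "'m \<Rightarrow> 'o"
  Id :: "'o \<Rightarrow> 'm"
  Comp :: "'m \<Rightarrow> 'm \<Rightarrow> 'm"  (infixr "\<cdot>\<index>" 75)

definition hom :: "('o, 'm, 'z) cat_scheme \<Rightarrow> 'o \<Rightarrow> 'o \<Rightarrow> 'm set" where
  "hom C X Y = {f \<in> Arr C. Dom C f = X \<and> Cod C f = Y}"

locale category =
  fixes C :: "('o, 'm, 'z) cat_scheme" (structure)
  assumes Dom_Obj: "f \<in> Arr C \<Longrightarrow> Dom C f \<in> Obj C"
    and Cod_Obj: "f \<in> Arr C \<Longrightarrow> Cod C f \<in> Obj C"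
    and Id_hom: "X \<in> Obj C \<Longrightarrow> Id C X \<in> hom C X X"
    and Comp_hom: "f \<in> hom C X Y \<Longrightarrow> g \<in> hom C Y Z \<Longrightarrow> g \<cdot> f \<in> hom C X Z"
    and Id_left: "f \<in> hom C X Y \<Longrightarrow> Id C Y \<cdot> f = f"
    and Id_right: "f \<in> hom C X Y \<Longrightarrow> f \<cdot> Id C X = f"
    and Comp_assoc: "f \<in> hom C W X \<Longrightarrow> g \<in> hom C X Y \<Longrightarrow> h \<in> hom C Y Z
      \<Longrightarrow> (h \<cdot> g) \<cdot> f = h \<cdot> (g \<cdot> f)"

locale cat_functor = C: category C + D: category D
  for C :: "('o, 'm, 'z) cat_scheme" and D :: "('p, 'n, 'y) cat_scheme" +
  fixes Fo :: "'o \<Rightarrow> 'p" and Fm :: "'m \<Rightarrow> 'n"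
  assumes Fo_Obj: "X \<in> Obj C \<Longrightarrow> Fo X \<in> Obj D"
    and Fm_hom: "f \<in> hom C X Y \<Longrightarrow> Fm f \<in> hom D (Fo X) (Fo Y)"
    and Fm_Id: "X \<in> Obj C \<Longrightarrow> Fm (Id C X) = Id D (Fo X)"
    and Fm_Comp: "f \<in> hom C X Y \<Longrightarrow> g \<in> hom C Y Z
      \<Longrightarrow> Fm (g \<cdot>\<^bsub>C\<^esub> f) = Fm g \<cdot>\<^bsub>D\<^esub> Fm f"

definition full_functor ::
  "('o, 'm, 'z) cat_scheme \<Rightarrow> ('p, 'n, 'y) cat_scheme \<Rightarrow> ('o \<Rightarrow> 'p) \<Rightarrow> ('m \<Rightarrow> 'n) \<Rightarrow> bool" where
  "full_functor C D Fo Fm \<longleftrightarrow>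
     (\<forall>X\<in>Obj C. \<forall>Y\<in>Obj C. \<forall>g\<in>hom D (Fo X) (Fo Y). \<exists>f\<in>hom C X Y. Fm f = g)"

definition faithful_functor :: "('o, 'm, 'z) cat_scheme \<Rightarrow> ('m \<Rightarrow> 'n) \<Rightarrow> bool" where
  "faithful_functor C Fm \<longleftrightarrow> (\<forall>X\<in>Obj C. \<forall>Y\<in>Obj C. inj_on Fm (hom C X Y))"

definition isomorphic_categories ::
  "('o, 'm, 'z) cat_scheme \<Rightarrow> ('p, 'n, 'y) cat_scheme \<Rightarrow> bool" where
  "isomorphic_categories C D \<longleftrightarrow>
     (\<exists>Fo Fm Go Gm. cat_functor C D Fo Fm \<and> cat_functor D C Go Gm \<and>
        (\<forall>X\<in>Obj C. Go (Fo X) = X) \<and> (\<forall>f\<in>Arr C. Gm (Fm f) = f) \<and>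
        (\<forall>Y\<in>Obj D. Fo (Go Y) = Y) \<and> (\<forall>g\<in>Arr D. Fm (Gm g) = g))"

definition full_subcategory :: "('o, 'm) cat \<Rightarrow> 'o set \<Rightarrow> ('o, 'm) cat" where
  "full_subcategory C S =
     C\<lparr>Obj := S \<inter> Obj C, Arr := {f \<in> Arr C. Dom C f \<in> S \<and> Cod C f \<in> S}\<rparr>"

text \<open>Categories of structured objects over \<open>C\<close>: objects are drawn from \<open>S\<close>, with carrier given by
  the first component. A morphism is an arrow of \<open>C\<close> tagged with its source and target structures,
  since the same arrow of \<open>C\<close> may underlie morphisms between different structures.\<close>

definition structured_cat ::
  "('o, 'm, 'z) cat_scheme \<Rightarrow> ('o \<times> 's) set \<Rightarrow> ('o \<times> 's \<Rightarrow> 'o \<times> 's \<Rightarrow> 'm \<Rightarrow> bool)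
    \<Rightarrow> ('o \<times> 's, ('o \<times> 's) \<times> ('o \<times> 's) \<times> 'm) cat" where
  "structured_cat C S P =
     \<lparr>Obj = S,
      Arr = {(x, y, f). x \<in> S \<and> y \<in> S \<and> f \<in> hom C (fst x) (fst y) \<and> P x y f},
      Dom = (\<lambda>(x, y, f). x),
      Cod = (\<lambda>(x, y, f). y),
      Id = (\<lambda>x. (x, x, Id C (fst x))),
      Comp = (\<lambda>(y', z, g) (x, y, f). (x, z, g \<cdot>\<^bsub>C\<^esub> f))\<rparr>"

lemma hom_structured_cat:
  "hom (structured_cat C S P) x y =
     {(x', y', f). x' = x \<and> y' = y \<and> x \<in> S \<and> y \<in> S \<and> f \<in> hom C (fst x) (fst y) \<and> P x y f}"
  by (auto simp: hom_def structured_cat_def)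

lemma category_structured_cat:
  fixes C :: "('o, 'm, 'z) cat_scheme" (structure)
  assumes C: "category C"
    and obj: "\<And>x. x \<in> S \<Longrightarrow> fst x \<in> Obj C"
    and ident: "\<And>x. x \<in> S \<Longrightarrow> P x x (Id C (fst x))"
    and comp: "\<And>x y z f g. \<lbrakk>x \<in> S; y \<in> S; z \<in> S; f \<in> hom C (fst x) (fst y);
      g \<in> hom C (fst y) (fst z); P x y f; P y z g\<rbrakk> \<Longrightarrow> P x z (g \<cdot> f)"
  shows "category (structured_cat C S P)"
proof -
  interpret category C by fact
  let ?D = "structured_cat C S P"
  have simps: "Obj ?D = S" "\<And>x. Id ?D x = (x, x, Id C (fst x))"
    "\<And>x y y' z f g. Comp ?D (y', z, g) (x, y, f) = (x, z, g \<cdot> f)"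
    by (auto simp: structured_cat_def)
  show ?thesis
  proof
    fix f assume "f \<in> Arr ?D"
    then show "Dom ?D f \<in> Obj ?D" "Cod ?D f \<in> Obj ?D"
      by (auto simp: structured_cat_def)
  next
    fix x assume "x \<in> Obj ?D"
    then show "Id ?D x \<in> hom ?D x x"
      by (simp add: hom_structured_cat simps Id_hom ident obj)
  next
    fix f g x y z assume "f \<in> hom ?D x y" "g \<in> hom ?D y z"
    then obtain f' g' where "f = (x, y, f')" "g = (y, z, g')" "x \<in> S" "y \<in> S" "z \<in> S"
      "f' \<in> hom C (fst x) (fst y)" "g' \<in> hom C (fst y) (fst z)" "P x y f'" "P y z g'"
      unfolding hom_structured_cat by blast
    then show "Comp ?D g f \<in> hom ?D x z"
      using Comp_hom[of f' "fst x" "fst y" g' "fst z"] comp[of x y z f' g']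
      by (simp add: hom_structured_cat simps)
  next
    fix f x y assume "f \<in> hom ?D x y"
    then show "Comp ?D (Id ?D y) f = f" "Comp ?D f (Id ?D x) = f"
      by (auto simp: hom_structured_cat simps intro: Id_left Id_right)
  next
    fix f g h w x y z assume "f \<in> hom ?D w x" "g \<in> hom ?D x y" "h \<in> hom ?D y z"
    then show "Comp ?D (Comp ?D h g) f = Comp ?D h (Comp ?D g f)"
      by (auto simp: hom_structured_cat simps intro: Comp_assoc)
  qed
qed

section \<open>Finite coproducts and Kleisli triples\<close>

record ('o, 'm) coprod_cat = "('o, 'm) cat" +
  Sum :: "'o \<Rightarrow> 'o \<Rightarrow> 'o"  (infixr "\<oplus>\<index>" 80)
  inl :: "'o \<Rightarrow> 'o \<Rightarrow> 'm"
  inr :: "'o \<Rightarrow> 'o \<Rightarrow> 'm"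

locale finite_coproducts = category C
  for C :: "('o, 'm) coprod_cat" (structure) +
  assumes initial: "\<exists>I\<in>Obj C. \<forall>X\<in>Obj C. \<exists>!f. f \<in> hom C I X"
    and Sum_Obj: "X \<in> Obj C \<Longrightarrow> Y \<in> Obj C \<Longrightarrow> X \<oplus> Y \<in> Obj C"
    and inl_hom: "X \<in> Obj C \<Longrightarrow> Y \<in> Obj C \<Longrightarrow> inl C X Y \<in> hom C X (X \<oplus> Y)"
    and inr_hom: "X \<in> Obj C \<Longrightarrow> Y \<in> Obj C \<Longrightarrow> inr C X Y \<in> hom C Y (X \<oplus> Y)"
    and copair_ex1: "X \<in> Obj C \<Longrightarrow> Y \<in> Obj C \<Longrightarrow> f \<in> hom C X Z \<Longrightarrow> g \<in> hom C Y Z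
      \<Longrightarrow> \<exists>!h. h \<in> hom C (X \<oplus> Y) Z \<and> h \<cdot> inl C X Y = f \<and> h \<cdot> inr C X Y = g"

text \<open>The object map of a monad need not be injective, so the codomain of \<open>f : X \<rightarrow> T Y\<close> does not
  determine \<open>Y\<close>; hence Kleisli extension (and the iteration operators on monads below) carry
  \<open>Y\<close> as an explicit index, whereas \<open>X\<close> is recovered as the domain of \<open>f\<close>.\<close>

record ('o, 'm) kleisli =
  TO :: "'o \<Rightarrow> 'o"
  eta :: "'o \<Rightarrow> 'm"
  ext :: "'o \<Rightarrow> 'm \<Rightarrow> 'm"

locale kleisli_triple = category C
  for C :: "('o, 'm, 'z) cat_scheme" (structure) +
  fixes T :: "('o, 'm) kleisli"
  assumes TO_Obj: "X \<in> Obj C \<Longrightarrow> TO T X \<in> Obj C"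
    and eta_hom: "X \<in> Obj C \<Longrightarrow> eta T X \<in> hom C X (TO T X)"
    and ext_hom: "X \<in> Obj C \<Longrightarrow> Y \<in> Obj C \<Longrightarrow> f \<in> hom C X (TO T Y)
      \<Longrightarrow> ext T Y f \<in> hom C (TO T X) (TO T Y)"
    and ext_eta: "X \<in> Obj C \<Longrightarrow> ext T X (eta T X) = Id C (TO T X)"
    and ext_unit: "X \<in> Obj C \<Longrightarrow> Y \<in> Obj C \<Longrightarrow> f \<in> hom C X (TO T Y)
      \<Longrightarrow> ext T Y f \<cdot> eta T X = f"
    and ext_ext: "X \<in> Obj C \<Longrightarrow> Y \<in> Obj C \<Longrightarrow> Z \<in> Obj C
      \<Longrightarrow> f \<in> hom C X (TO T Y) \<Longrightarrow> g \<in> hom C Y (TO T Z)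
      \<Longrightarrow> ext T Z (ext T Z g \<cdot> f) = ext T Z g \<cdot> ext T Y f"

context
  fixes C :: "('o, 'm) coprod_cat" (structure)
begin

definition copair :: "'m \<Rightarrow> 'm \<Rightarrow> 'm" where
  "copair f g = (THE h. h \<in> hom C (Dom C f \<oplus> Dom C g) (Cod C f) \<and>
     h \<cdot> inl C (Dom C f) (Dom C g) = f \<and> h \<cdot> inr C (Dom C f) (Dom C g) = g)"

definition sum_arr :: "'m \<Rightarrow> 'm \<Rightarrow> 'm" where
  "sum_arr f g = copair (inl C (Cod C f) (Cod C g) \<cdot> f) (inr C (Cod C f) (Cod C g) \<cdot> g)"

definition codiag :: "'o \<Rightarrow> 'm" where
  "codiag A = copair (Id C A) (Id C A)"

end

definition Tmap :: "('o, 'm, 'z) cat_scheme \<Rightarrow> ('o, 'm) kleisli \<Rightarrow> 'm \<Rightarrow> 'm" where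
  "Tmap C T f = ext T (Cod C f) (eta T (Cod C f) \<cdot>\<^bsub>C\<^esub> f)"

definition mu :: "('o, 'm, 'z) cat_scheme \<Rightarrow> ('o, 'm) kleisli \<Rightarrow> 'o \<Rightarrow> 'm" where
  "mu C T Y = ext T Y (Id C (TO T Y))"

section \<open>Eilenberg--Moore algebras\<close>

definition EM_algebra :: "('o, 'm, 'z) cat_scheme \<Rightarrow> ('o, 'm) kleisli \<Rightarrow> 'o \<Rightarrow> 'm \<Rightarrow> bool" where
  "EM_algebra C T A a \<longleftrightarrow>
     A \<in> Obj C \<and> a \<in> hom C (TO T A) A \<and>
     a \<cdot>\<^bsub>C\<^esub> eta T A = Id C A \<and> a \<cdot>\<^bsub>C\<^esub> Tmap C T a = a \<cdot>\<^bsub>C\<^esub> mu C T A"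

definition EM :: "('o, 'm, 'z) cat_scheme \<Rightarrow> ('o, 'm) kleisli
    \<Rightarrow> ('o \<times> 'm, ('o \<times> 'm) \<times> ('o \<times> 'm) \<times> 'm) cat" where
  "EM C T = structured_cat C {(A, a). EM_algebra C T A a}
     (\<lambda>(A, a) (B, b) f. f \<cdot>\<^bsub>C\<^esub> a = b \<cdot>\<^bsub>C\<^esub> Tmap C T f)"

section \<open>Complete Elgot algebras and weak complete Elgot monads\<close>

context
  fixes C :: "('o, 'm) coprod_cat" (structure) and T :: "('o, 'm) kleisli"
begin

definition hash_obj :: "'o \<Rightarrow> 'o \<Rightarrow> 'o"  (infixr "\<sharp>" 70) where
  "X \<sharp> Y = TO T (X \<oplus> Y)"

definition hash_arr :: "'m \<Rightarrow> 'm \<Rightarrow> 'm"  (infixr "\<sharp>\<sharp>" 77) where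
  "f \<sharp>\<sharp> g = Tmap C T (sum_arr C f g)"

definition hash_unit :: "'o \<Rightarrow> 'o \<Rightarrow> 'm" where
  "hash_unit Y X = eta T (X \<oplus> Y) \<cdot> inl C X Y"

definition hash_mult :: "'o \<Rightarrow> 'o \<Rightarrow> 'm" where
  "hash_mult Y X = ext T (X \<oplus> Y) (copair C (Id C (X \<sharp> Y)) (eta T (X \<oplus> Y) \<cdot> inr C X Y))"

definition hash_algebra :: "'o \<Rightarrow> 'm \<Rightarrow> bool" where
  "hash_algebra A a \<longleftrightarrow>
     A \<in> Obj C \<and> a \<in> hom C (A \<sharp> A) A \<and>
     a \<cdot> hash_unit A A = Id C A \<and> a \<cdot> (a \<sharp>\<sharp> Id C A) = a \<cdot> hash_mult A A"

text \<open>The following two operations are \<open>s \<bullet> g\<close> for \<open>s : Y \<rightarrow> A\<close> and \<open>f \<blacksquare> g\<close> for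
  \<open>f : Y \<rightarrow> A \<sharp> Y\<close>, where \<open>g : X \<rightarrow> Y \<sharp> X\<close>.\<close>

definition elg_bullet :: "'o \<Rightarrow> 'm \<Rightarrow> 'm \<Rightarrow> 'm" where
  "elg_bullet X s g = (s \<sharp>\<sharp> Id C X) \<cdot> g"

definition elg_square :: "'o \<Rightarrow> 'o \<Rightarrow> 'o \<Rightarrow> 'm \<Rightarrow> 'm \<Rightarrow> 'm" where
  "elg_square A Y X f g =
     hash_mult (Y \<oplus> X) A \<cdot> (((Id C A \<sharp>\<sharp> inl C Y X) \<cdot> f) \<sharp>\<sharp> inr C Y X) \<cdot> copair C (hash_unit X Y) g"

text \<open>Extensionality of the iteration operator makes two complete Elgot algebras equal as soon as
  their carriers, structures and iteration operators (on arrows \<open>X \<rightarrow> A \<sharp> X\<close>) agree.\<close>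

definition complete_elgot_algebra :: "'o \<Rightarrow> 'm \<Rightarrow> ('m \<Rightarrow> 'm) \<Rightarrow> bool" where
  "complete_elgot_algebra A a sol \<longleftrightarrow>
     hash_algebra A a \<and>
     sol \<in> extensional (\<Union>X\<in>Obj C. hom C X (A \<sharp> X)) \<and>
     (\<forall>X\<in>Obj C. \<forall>e\<in>hom C X (A \<sharp> X). sol e \<in> hom C X A) \<and>
     (\<forall>X\<in>Obj C. \<forall>e\<in>hom C X (A \<sharp> X). sol e = a \<cdot> (Id C A \<sharp>\<sharp> sol e) \<cdot> e) \<and>
     (\<forall>X\<in>Obj C. \<forall>Y\<in>Obj C. \<forall>e\<in>hom C X (A \<sharp> X). \<forall>f\<in>hom C Y (A \<sharp> Y). \<forall>h\<in>hom C X Y.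
        f \<cdot> h = (Id C A \<sharp>\<sharp> h) \<cdot> e \<longrightarrow> sol f \<cdot> h = sol e) \<and>
     (\<forall>X\<in>Obj C. \<forall>Y\<in>Obj C. \<forall>f\<in>hom C Y (A \<sharp> Y). \<forall>g\<in>hom C X (Y \<sharp> X).
        sol (elg_square A Y X f g) \<cdot> inr C Y X = sol (elg_bullet X (sol f) g))"

definition CElg :: "('o \<times> 'm \<times> ('m \<Rightarrow> 'm),
    ('o \<times> 'm \<times> ('m \<Rightarrow> 'm)) \<times> ('o \<times> 'm \<times> ('m \<Rightarrow> 'm)) \<times> 'm) cat" where
  "CElg = structured_cat C {(A, a, sol). complete_elgot_algebra A a sol}
     (\<lambda>(A, a, sol) (B, b, sol') f.
        \<forall>X\<in>Obj C. \<forall>e\<in>hom C X (A \<sharp> X). sol' ((f \<sharp>\<sharp> Id C X) \<cdot> e) = f \<cdot> sol e)"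

text \<open>\<open>dag Y f\<close> is \<open>f\<^sup>\<dagger> : X \<rightarrow> T Y\<close> for \<open>f : X \<rightarrow> T (Y \<oplus> X)\<close>.\<close>

definition weak_complete_elgot_monad :: "('o \<Rightarrow> 'm \<Rightarrow> 'm) \<Rightarrow> bool" where
  "weak_complete_elgot_monad dag \<longleftrightarrow>
     kleisli_triple C T \<and>
     (\<forall>X\<in>Obj C. \<forall>Y\<in>Obj C. \<forall>f\<in>hom C X (TO T (Y \<oplus> X)). dag Y f \<in> hom C X (TO T Y)) \<and>
     (\<forall>X\<in>Obj C. \<forall>Y\<in>Obj C. \<forall>f\<in>hom C X (TO T (Y \<oplus> X)).
        dag Y f = ext T Y (copair C (eta T Y) (dag Y f)) \<cdot> f) \<and>
     (\<forall>X\<in>Obj C. \<forall>Y\<in>Obj C. \<forall>Z\<in>Obj C. \<forall>f\<in>hom C X (TO T (Y \<oplus> X)). \<forall>g\<in>hom C Y (TO T Z).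
        ext T Z g \<cdot> dag Y f =
        dag Z (ext T (Z \<oplus> X)
          (copair C (Tmap C T (inl C Z X) \<cdot> g) (eta T (Z \<oplus> X) \<cdot> inr C Z X)) \<cdot> f)) \<and>
     (\<forall>X\<in>Obj C. \<forall>Y\<in>Obj C. \<forall>Z\<in>Obj C. \<forall>f\<in>hom C X (TO T (Y \<oplus> X)). \<forall>g\<in>hom C Z (TO T (Y \<oplus> Z)).
        \<forall>h\<in>hom C Z X.
        f \<cdot> h = Tmap C T (sum_arr C (Id C Y) h) \<cdot> g \<longrightarrow> dag Y f \<cdot> h = dag Y g) \<and>
     (\<forall>X\<in>Obj C. \<forall>Y\<in>Obj C. \<forall>Z\<in>Obj C. \<forall>g\<in>hom C X (TO T (Y \<oplus> X)). \<forall>f\<in>hom C Y (TO T (Z \<oplus> Y)).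
        let w = ext T (Z \<oplus> (Y \<oplus> X))
              (copair C (Tmap C T (sum_arr C (Id C Z) (inl C Y X)) \<cdot> f)
                (eta T (Z \<oplus> (Y \<oplus> X)) \<cdot> inr C Z (Y \<oplus> X) \<cdot> inr C Y X))
            \<cdot> copair C (eta T (Y \<oplus> X) \<cdot> inl C Y X) g
        in dag Z w \<cdot> inr C Y X = ext T Z (dag Z f) \<cdot> dag Y g)"

end

section \<open>The categories of algebras are categories\<close>

context category
begin

lemma hom_Obj: "f \<in> hom C X Y \<Longrightarrow> X \<in> Obj C" "f \<in> hom C X Y \<Longrightarrow> Y \<in> Obj C"
  using Dom_Obj Cod_Obj by (auto simp: hom_def)

lemma hom_Dom_Cod: "f \<in> hom C X Y \<Longrightarrow> Dom C f = X" "f \<in> hom C X Y \<Longrightarrow> Cod C f = Y"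
  by (auto simp: hom_def)

end

context finite_coproducts
begin

lemma copair:
  assumes f: "f \<in> hom C X Z" and g: "g \<in> hom C Y Z"
  shows copair_hom: "copair C f g \<in> hom C (X \<oplus> Y) Z"
    and copair_inl: "copair C f g \<cdot> inl C X Y = f"
    and copair_inr: "copair C f g \<cdot> inr C X Y = g"
  using theI'[OF copair_ex1[OF hom_Obj(1)[OF f] hom_Obj(1)[OF g] f g]]
    hom_Dom_Cod[OF f] hom_Dom_Cod[OF g]
  by (auto simp: copair_def)

lemma copair_unique:
  assumes "X \<in> Obj C" "Y \<in> Obj C" "h \<in> hom C (X \<oplus> Y) Z"
    "h \<cdot> inl C X Y = f" "h \<cdot> inr C X Y = g"
  shows "h = copair C f g"
proof -
  have f: "f \<in> hom C X Z" and g: "g \<in> hom C Y Z"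
    using assms Comp_hom inl_hom inr_hom by blast+
  show ?thesis
    using copair_ex1[OF assms(1,2) f g] copair[OF f g] assms(3-5) by blast
qed

lemma sum_arr_hom:
  assumes "f \<in> hom C X X'" "g \<in> hom C Y Y'"
  shows "sum_arr C f g \<in> hom C (X \<oplus> Y) (X' \<oplus> Y')"
  using assms hom_Obj[OF assms(1)] hom_Obj[OF assms(2)]
  by (auto simp: sum_arr_def hom_Dom_Cod intro!: copair_hom intro: Comp_hom inl_hom inr_hom)

lemma sum_arr_inj:
  assumes f: "f \<in> hom C X X'" and g: "g \<in> hom C Y Y'"
  shows sum_arr_inl: "sum_arr C f g \<cdot> inl C X Y = inl C X' Y' \<cdot> f"
    and sum_arr_inr: "sum_arr C f g \<cdot> inr C X Y = inr C X' Y' \<cdot> g"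
proof -
  have "inl C X' Y' \<cdot> f \<in> hom C X (X' \<oplus> Y')" "inr C X' Y' \<cdot> g \<in> hom C Y (X' \<oplus> Y')"
    using f g hom_Obj[OF f] hom_Obj[OF g] by (blast intro: Comp_hom inl_hom inr_hom)+
  from copair_inl[OF this] copair_inr[OF this]
  show "sum_arr C f g \<cdot> inl C X Y = inl C X' Y' \<cdot> f" "sum_arr C f g \<cdot> inr C X Y = inr C X' Y' \<cdot> g"
    by (simp_all add: sum_arr_def hom_Dom_Cod[OF f] hom_Dom_Cod[OF g])
qed

lemma sum_arr_Id:
  assumes "X \<in> Obj C" "Y \<in> Obj C"
  shows "sum_arr C (Id C X) (Id C Y) = Id C (X \<oplus> Y)"
proof -
  have "Id C (X \<oplus> Y) = copair C (inl C X Y) (inr C X Y)"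
    by (rule copair_unique[OF assms])
      (use assms in \<open>auto intro: Id_hom Sum_Obj Id_left inl_hom inr_hom\<close>)
  then show ?thesis
    by (simp add: sum_arr_def hom_Dom_Cod(2)[OF Id_hom] assms
        Id_right[OF inl_hom[OF assms]] Id_right[OF inr_hom[OF assms]])
qed

lemma sum_arr_Comp:
  assumes f: "f \<in> hom C X X'" and f': "f' \<in> hom C X' X''"
    and g: "g \<in> hom C Y Y'" and g': "g' \<in> hom C Y' Y''"
  shows "sum_arr C (f' \<cdot> f) (g' \<cdot> g) = sum_arr C f' g' \<cdot> sum_arr C f g"
proof -
  note obj = hom_Obj[OF f] hom_Obj[OF g] hom_Obj[OF f'] hom_Obj[OF g']
  have "(sum_arr C f' g' \<cdot> sum_arr C f g) \<cdot> inl C X Y = inl C X'' Y'' \<cdot> f' \<cdot> f"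
    using Comp_assoc[OF inl_hom sum_arr_hom[OF f g] sum_arr_hom[OF f' g']]
      Comp_assoc[OF f inl_hom sum_arr_hom[OF f' g']] Comp_assoc[OF f f' inl_hom]
    by (simp add: obj sum_arr_inl[OF f g] sum_arr_inl[OF f' g'])
  moreover have "(sum_arr C f' g' \<cdot> sum_arr C f g) \<cdot> inr C X Y = inr C X'' Y'' \<cdot> g' \<cdot> g"
    using Comp_assoc[OF inr_hom sum_arr_hom[OF f g] sum_arr_hom[OF f' g']]
      Comp_assoc[OF g inr_hom sum_arr_hom[OF f' g']] Comp_assoc[OF g g' inr_hom]
    by (simp add: obj sum_arr_inr[OF f g] sum_arr_inr[OF f' g'])
  ultimately show ?thesis
    using copair_unique[OF obj(1,3) Comp_hom[OF sum_arr_hom[OF f g] sum_arr_hom[OF f' g']]]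
      hom_Dom_Cod(2)[OF Comp_hom[OF f f']] hom_Dom_Cod(2)[OF Comp_hom[OF g g']]
    by (simp add: sum_arr_def[of C "f' \<cdot> f"])
qed

end

context kleisli_triple
begin

lemma Tmap_hom:
  assumes "f \<in> hom C X Y"
  shows "Tmap C T f \<in> hom C (TO T X) (TO T Y)"
  using assms hom_Obj[OF assms]
  by (auto simp: Tmap_def hom_Dom_Cod intro!: ext_hom intro: Comp_hom eta_hom)

lemma Tmap_Id: "X \<in> Obj C \<Longrightarrow> Tmap C T (Id C X) = Id C (TO T X)"
  by (simp add: Tmap_def hom_Dom_Cod(2)[OF Id_hom] Id_right[OF eta_hom] ext_eta)

lemma Tmap_Comp:
  assumes f: "f \<in> hom C X Y" and g: "g \<in> hom C Y Z"
  shows "Tmap C T (g \<cdot> f) = Tmap C T g \<cdot> Tmap C T f"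
proof -
  note obj = hom_Obj[OF f] hom_Obj(2)[OF g]
  have ef: "eta T Y \<cdot> f \<in> hom C X (TO T Y)" and eg: "eta T Z \<cdot> g \<in> hom C Y (TO T Z)"
    using f g obj by (blast intro: Comp_hom eta_hom)+
  have "ext T Z (eta T Z \<cdot> g) \<cdot> eta T Y \<cdot> f = eta T Z \<cdot> g \<cdot> f"
    using Comp_assoc[OF f eta_hom ext_hom[OF _ _ eg]] ext_unit[OF _ _ eg] Comp_assoc[OF f g eta_hom]
    by (simp add: obj)
  then show ?thesis
    using ext_ext[OF obj ef eg]
    by (simp add: Tmap_def hom_Dom_Cod[OF f] hom_Dom_Cod[OF g] hom_Dom_Cod[OF Comp_hom[OF f g]])
qed

lemma category_EM: "category (EM C T)"
  unfolding EM_def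
proof (rule category_structured_cat, safe, goal_cases)
  case 1
  show ?case by (rule category_axioms)
next
  case (2 A a)
  then show ?case by (simp add: EM_algebra_def)
next
  case (3 A a)
  then show ?case
    by (auto simp: EM_algebra_def Tmap_Id Id_left Id_right)
next
  case (4 A a B b D d f g)
  then have hyps: "f \<in> hom C A B" "g \<in> hom C B D" "a \<in> hom C (TO T A) A"
    "b \<in> hom C (TO T B) B" "d \<in> hom C (TO T D) D"
    by (auto simp: EM_algebra_def)
  have "(g \<cdot> f) \<cdot> a = g \<cdot> b \<cdot> Tmap C T f"
    using Comp_assoc[OF hyps(3,1,2)] 4 by simp
  also have "\<dots> = (d \<cdot> Tmap C T g) \<cdot> Tmap C T f"
    using Comp_assoc[OF Tmap_hom[OF hyps(1)] hyps(4,2)] 4 by simp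
  also have "\<dots> = d \<cdot> Tmap C T (g \<cdot> f)"
    using Comp_assoc[OF Tmap_hom[OF hyps(1)] Tmap_hom[OF hyps(2)] hyps(5)]
    by (simp add: Tmap_Comp[OF hyps(1,2)])
  finally show ?case by simp
qed

end

lemma category_CElg:
  assumes "finite_coproducts C" and "kleisli_triple C T"
  shows "category (CElg C T)"
proof -
  interpret finite_coproducts C by fact
  interpret kleisli_triple C T by fact
  show ?thesis
    unfolding CElg_def
  proof (rule category_structured_cat, safe, goal_cases)
    case 1
    show ?case by (rule category_axioms)
  next
    case (2 A a s)
    then show ?case by (simp add: complete_elgot_algebra_def hash_algebra_def)
  next
    case (3 A a s X e)
    then have A: "A \<in> Obj C" and s: "s e \<in> hom C X A"
      by (auto simp: complete_elgot_algebra_def hash_algebra_def)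
    have "Comp C (hash_arr C T (Id C A) (Id C X)) e = e"
      using 3 A by (simp add: hash_arr_def sum_arr_Id Tmap_Id Sum_Obj Id_left hash_obj_def)
    then show ?case using Id_left[OF s] by simp
  next
    case (4 A a s B b s' D d s'' f g X e)
    then have f: "f \<in> hom C A B" and g: "g \<in> hom C B D" and X: "X \<in> Obj C"
      and e: "e \<in> hom C X (hash_obj C T A X)" and s: "s e \<in> hom C X A"
      by (auto simp: complete_elgot_algebra_def hash_algebra_def)
    note fX = sum_arr_hom[OF f Id_hom[OF X]] and gX = sum_arr_hom[OF g Id_hom[OF X]]
    have e': "Comp C (hash_arr C T f (Id C X)) e \<in> hom C X (hash_obj C T B X)"
      using Comp_hom[OF e[unfolded hash_obj_def] Tmap_hom[OF fX]]
      by (simp add: hash_arr_def hash_obj_def)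
    have "sum_arr C (Comp C g f) (Id C X)
        = Comp C (sum_arr C g (Id C X)) (sum_arr C f (Id C X))"
      using sum_arr_Comp[OF f g Id_hom[OF X] Id_hom[OF X]] Id_left[OF Id_hom[OF X]] by simp
    then have "Comp C (hash_arr C T (Comp C g f) (Id C X)) e
        = Comp C (hash_arr C T g (Id C X)) (Comp C (hash_arr C T f (Id C X)) e)"
      using Comp_assoc[OF e[unfolded hash_obj_def] Tmap_hom[OF fX] Tmap_hom[OF gX]]
      by (simp add: hash_arr_def Tmap_Comp[OF fX gX])
    then show ?case
      using 4 e' X e Comp_assoc[OF s f g] by simp
  qed
qed

end

theory Submission
  imports Defs
begin

text \<open>For a weak complete Elgot monad, \<open>a \<circ> e\<^sup>\<dagger>\<close> is a solution operator on every Eilenberg--Moore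
  algebra \<open>(A, a)\<close>, the axioms following from those of \<open>\<dagger>\<close> because \<open>a \<circ> k\<^sup>* = a \<circ> T(a \<circ> k)\<close>.
  Conversely the structure \<open>a\<close> is recovered from iteration as the solution of
  \<open>T inl : TA \<rightarrow> T(A + TA)\<close>, so iteration-preserving arrows are algebra homomorphisms; this gives
  the isomorphism in (i) and fullness in (ii). In (ii), all axioms of \<open>\<dagger>\<close> except naturality are
  read off from those of the algebras \<open>J(TY, \<mu>)\<close>, using that each \<open>g\<^sup>*\<close> is an algebra homomorphism;
  naturality additionally needs compositionality for that same equation \<open>T inl\<close>.

  Equations between arrows are decided by rewriting: \<open>Tmap\<close> is unfolded to \<open>ext\<close> and \<open>sum_arr\<close> to
  \<open>copair\<close>, and the side conditions are phrased with \<open>Dom\<close> and \<open>Cod\<close> rather than \<open>hom\<close> so that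
  they contain no extra variables.\<close>

section \<open>Full subcategories and isomorphisms of categories of structured objects\<close>

lemma category_full_subcategory:
  assumes "category C"
  shows "category (full_subcategory C S)"
proof -
  interpret category C by fact
  have hom: "f \<in> hom (full_subcategory C S) X Y \<longleftrightarrow> f \<in> hom C X Y \<and> X \<in> S \<and> Y \<in> S" for f X Y
    by (auto simp: hom_def full_subcategory_def)
  have simps: "Id (full_subcategory C S) = Id C" "Comp (full_subcategory C S) = Comp C"
    "Obj (full_subcategory C S) = S \<inter> Obj C"
    by (auto simp: full_subcategory_def)
  show ?thesis
  proof (unfold_locales, unfold hom simps)
    fix f assume "f \<in> Arr (full_subcategory C S)"
    then show "Dom (full_subcategory C S) f \<in> S \<inter> Obj C"
      "Cod (full_subcategory C S) f \<in> S \<inter> Obj C"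
      by (auto simp: full_subcategory_def Dom_Obj Cod_Obj)
  qed (auto intro: Id_hom Comp_hom Id_left Id_right Comp_assoc)
qed

lemma full_subcategory_structured_cat:
  "full_subcategory (structured_cat C S P) S' = structured_cat C (S' \<inter> S) P"
  by (auto simp: full_subcategory_def structured_cat_def)

text \<open>Both functors keep the underlying arrow of \<open>C\<close> and only change its source
  and target tags, by \<open>F\<close> in one direction and by its inverse in the other. Since
  carriers are preserved, identities and composites agree automatically.\<close>

lemma isomorphic_structured_cats:
  assumes cats: "category (structured_cat C S P)" "category (structured_cat C S' P')"
    and bij: "bij_betw F S S'"
    and carrier: "\<And>x. x \<in> S \<Longrightarrow> fst (F x) = fst x"
    and mor_iff: "\<And>x y f. x \<in> S \<Longrightarrow> y \<in> S \<Longrightarrow> f \<in> hom C (fst x) (fst y) \<Longrightarrow>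
      P' (F x) (F y) f \<longleftrightarrow> P x y f"
  shows "isomorphic_categories (structured_cat C S P) (structured_cat C S' P')"
proof -
  define G where "G = inv_into S F"
  have F: "F x \<in> S'" and GF: "G (F x) = x" if "x \<in> S" for x
    using bij that by (auto simp: G_def bij_betw_def)
  have G: "G y \<in> S" and FG: "F (G y) = y" if "y \<in> S'" for y
    using bij that by (auto simp: G_def bij_betw_def inv_into_into f_inv_into_f)
  have carrier_G: "fst (G y) = fst y" if "y \<in> S'" for y
    using carrier[OF G[OF that]] FG[OF that] by simp
  have mor_iff_G: "P (G x) (G y) f \<longleftrightarrow> P' x y f"
    if "x \<in> S'" "y \<in> S'" "f \<in> hom C (fst x) (fst y)" for x y f
    using mor_iff[OF G[OF that(1)] G[OF that(2)], of f] that
    by (simp add: carrier_G FG)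
  let ?Fm = "\<lambda>(x, y, f). (F x, F y, f)" and ?Gm = "\<lambda>(x, y, f). (G x, G y, f)"
  have "cat_functor (structured_cat C S P) (structured_cat C S' P') F ?Fm"
    using F carrier mor_iff
    by (intro cat_functor.intro cats cat_functor_axioms.intro)
      (auto simp: hom_structured_cat, auto simp: structured_cat_def)
  moreover have "cat_functor (structured_cat C S' P') (structured_cat C S P) G ?Gm"
    using G carrier_G mor_iff_G
    by (intro cat_functor.intro cats cat_functor_axioms.intro)
      (auto simp: hom_structured_cat, auto simp: structured_cat_def)
  ultimately show ?thesis
    unfolding isomorphic_categories_def
    by (rule_tac exI[of _ F], rule_tac exI[of _ ?Fm], rule_tac exI[of _ G], rule_tac exI[of _ ?Gm])
      (auto simp: structured_cat_def GF FG)
qed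

section \<open>Rewrite rules for coproducts and Kleisli extension\<close>

locale kleisli_coproducts = finite_coproducts C + kleisli_triple C T
  for C :: "('o, 'm) coprod_cat" (structure) and T :: "('o, 'm) kleisli"
begin

lemma Obj_simps [simp]:
  "f \<in> Arr C \<Longrightarrow> Dom C f \<in> Obj C" "f \<in> Arr C \<Longrightarrow> Cod C f \<in> Obj C"
  "X \<in> Obj C \<Longrightarrow> Y \<in> Obj C \<Longrightarrow> X \<oplus> Y \<in> Obj C"
  "X \<in> Obj C \<Longrightarrow> TO T X \<in> Obj C"
  by (auto intro: Dom_Obj Cod_Obj Sum_Obj TO_Obj)

lemma Arr_simps [simp]:
  "f \<in> Arr C \<Longrightarrow> g \<in> Arr C \<Longrightarrow> Cod C f = Dom C g \<Longrightarrow>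
     g \<cdot> f \<in> Arr C \<and> Dom C (g \<cdot> f) = Dom C f \<and> Cod C (g \<cdot> f) = Cod C g"
  "X \<in> Obj C \<Longrightarrow> Id C X \<in> Arr C \<and> Dom C (Id C X) = X \<and> Cod C (Id C X) = X"
  "X \<in> Obj C \<Longrightarrow> Y \<in> Obj C \<Longrightarrow>
     inl C X Y \<in> Arr C \<and> Dom C (inl C X Y) = X \<and> Cod C (inl C X Y) = X \<oplus> Y"
  "X \<in> Obj C \<Longrightarrow> Y \<in> Obj C \<Longrightarrow>
     inr C X Y \<in> Arr C \<and> Dom C (inr C X Y) = Y \<and> Cod C (inr C X Y) = X \<oplus> Y"
  "f \<in> Arr C \<Longrightarrow> g \<in> Arr C \<Longrightarrow> Cod C f = Cod C g \<Longrightarrow>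
     copair C f g \<in> Arr C \<and> Dom C (copair C f g) = Dom C f \<oplus> Dom C g
       \<and> Cod C (copair C f g) = Cod C g"
  "X \<in> Obj C \<Longrightarrow> eta T X \<in> Arr C \<and> Dom C (eta T X) = X \<and> Cod C (eta T X) = TO T X"
  "f \<in> Arr C \<Longrightarrow> Y \<in> Obj C \<Longrightarrow> Cod C f = TO T Y \<Longrightarrow>
     ext T Y f \<in> Arr C \<and> Dom C (ext T Y f) = TO T (Dom C f) \<and> Cod C (ext T Y f) = TO T Y"
  using Comp_hom[of f "Dom C f" "Cod C f" g "Cod C g"] Id_hom[of X] inl_hom[of X Y]
    inr_hom[of X Y] copair_hom[of f "Dom C f" "Cod C f" g "Dom C g"] eta_hom[of X]
    ext_hom[of "Dom C f" Y f]
  by (simp_all add: hom_def)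

lemma Comp_simps [simp]:
  "f \<in> Arr C \<Longrightarrow> g \<in> Arr C \<Longrightarrow> h \<in> Arr C \<Longrightarrow> Cod C f = Dom C g \<Longrightarrow> Cod C g = Dom C h \<Longrightarrow>
     (h \<cdot> g) \<cdot> f = h \<cdot> (g \<cdot> f)"
  "f \<in> Arr C \<Longrightarrow> Cod C f = X \<Longrightarrow> Id C X \<cdot> f = f"
  "f \<in> Arr C \<Longrightarrow> Dom C f = X \<Longrightarrow> f \<cdot> Id C X = f"
  using Comp_assoc[of f "Dom C f" "Cod C f" g "Cod C g" h "Cod C h"]
    Id_left[of f "Dom C f" X] Id_right[of f X "Cod C f"]
  by (simp_all add: hom_def)

text \<open>The last two rules carry a further factor \<open>k\<close>: composites are normalised to
  right-nested form, in which \<open>copair C f g \<cdot> inl C X Y\<close> may fail to be a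
  subterm.\<close>

lemma copair_simps [simp]:
  "f \<in> Arr C \<Longrightarrow> g \<in> Arr C \<Longrightarrow> Cod C f = Cod C g \<Longrightarrow> Dom C f = X \<Longrightarrow> Dom C g = Y \<Longrightarrow>
     copair C f g \<cdot> inl C X Y = f"
  "f \<in> Arr C \<Longrightarrow> g \<in> Arr C \<Longrightarrow> Cod C f = Cod C g \<Longrightarrow> Dom C f = X \<Longrightarrow> Dom C g = Y \<Longrightarrow>
     copair C f g \<cdot> inr C X Y = g"
  "f \<in> Arr C \<Longrightarrow> g \<in> Arr C \<Longrightarrow> k \<in> Arr C \<Longrightarrow> Cod C f = Cod C g \<Longrightarrow> Dom C f = X \<Longrightarrow>
     Dom C g = Y \<Longrightarrow> Cod C k = X \<Longrightarrow> copair C f g \<cdot> inl C X Y \<cdot> k = f \<cdot> k"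
  "f \<in> Arr C \<Longrightarrow> g \<in> Arr C \<Longrightarrow> k \<in> Arr C \<Longrightarrow> Cod C f = Cod C g \<Longrightarrow> Dom C f = X \<Longrightarrow>
     Dom C g = Y \<Longrightarrow> Cod C k = Y \<Longrightarrow> copair C f g \<cdot> inr C X Y \<cdot> k = g \<cdot> k"
proof -
  assume a: "f \<in> Arr C" "g \<in> Arr C" "Cod C f = Cod C g" "Dom C f = X" "Dom C g = Y"
  then show 1: "copair C f g \<cdot> inl C X Y = f" and 2: "copair C f g \<cdot> inr C X Y = g"
    using copair_inl[of f X "Cod C g" g Y] copair_inr[of f X "Cod C g" g Y]
    by (simp_all add: hom_def)
  have o: "X \<in> Obj C" "Y \<in> Obj C" using a by auto
  assume k: "k \<in> Arr C"
  show "Cod C k = X \<Longrightarrow> copair C f g \<cdot> inl C X Y \<cdot> k = f \<cdot> k"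
    using Comp_simps(1)[of k "inl C X Y" "copair C f g"] a k o 1 by simp
  show "Cod C k = Y \<Longrightarrow> copair C f g \<cdot> inr C X Y \<cdot> k = g \<cdot> k"
    using Comp_simps(1)[of k "inr C X Y" "copair C f g"] a k o 2 by simp
qed

lemma copair_eta:
  "h \<in> Arr C \<Longrightarrow> X \<in> Obj C \<Longrightarrow> Y \<in> Obj C \<Longrightarrow> Dom C h = X \<oplus> Y \<Longrightarrow>
     copair C (h \<cdot> inl C X Y) (h \<cdot> inr C X Y) = h"
  using copair_unique[of X Y h "Cod C h"] by (simp add: hom_def)

lemma comp_copair [simp]:
  assumes "f \<in> Arr C" "g \<in> Arr C" "h \<in> Arr C" "Cod C f = Cod C g" "Cod C g = Dom C h"
  shows "h \<cdot> copair C f g = copair C (h \<cdot> f) (h \<cdot> g)"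
  using copair_eta[of "h \<cdot> copair C f g" "Dom C f" "Dom C g"] assms by simp

text \<open>The associativity law is oriented so that adjacent extensions merge into one, whose
  argument can then be simplified further. The third and fifth rules are the second and fourth with
  a further factor \<open>k\<close>.\<close>

lemma ext_simps [simp]:
  "X \<in> Obj C \<Longrightarrow> ext T X (eta T X) = Id C (TO T X)"
  "f \<in> Arr C \<Longrightarrow> Y \<in> Obj C \<Longrightarrow> Cod C f = TO T Y \<Longrightarrow> Dom C f = X \<Longrightarrow>
     ext T Y f \<cdot> eta T X = f"
  "f \<in> Arr C \<Longrightarrow> Y \<in> Obj C \<Longrightarrow> Cod C f = TO T Y \<Longrightarrow> Dom C f = X \<Longrightarrow> k \<in> Arr C \<Longrightarrow>
     Cod C k = X \<Longrightarrow> ext T Y f \<cdot> eta T X \<cdot> k = f \<cdot> k"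
  "f \<in> Arr C \<Longrightarrow> g \<in> Arr C \<Longrightarrow> Y \<in> Obj C \<Longrightarrow> Z \<in> Obj C \<Longrightarrow> Cod C f = TO T Y \<Longrightarrow>
     Cod C g = TO T Z \<Longrightarrow> Dom C g = Y \<Longrightarrow>
     ext T Z g \<cdot> ext T Y f = ext T Z (ext T Z g \<cdot> f)"
  "f \<in> Arr C \<Longrightarrow> g \<in> Arr C \<Longrightarrow> Y \<in> Obj C \<Longrightarrow> Z \<in> Obj C \<Longrightarrow> Cod C f = TO T Y \<Longrightarrow>
     Cod C g = TO T Z \<Longrightarrow> Dom C g = Y \<Longrightarrow> k \<in> Arr C \<Longrightarrow> Cod C k = TO T (Dom C f) \<Longrightarrow>
     ext T Z g \<cdot> ext T Y f \<cdot> k = ext T Z (ext T Z g \<cdot> f) \<cdot> k"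
proof -
  show "X \<in> Obj C \<Longrightarrow> ext T X (eta T X) = Id C (TO T X)"
    by (rule ext_eta)
  assume f: "f \<in> Arr C" and Y: "Y \<in> Obj C" and fY: "Cod C f = TO T Y"
  {
    assume X: "Dom C f = X"
    then have XO: "X \<in> Obj C" using f by auto
    show 1: "ext T Y f \<cdot> eta T X = f"
      using ext_unit[of X Y f] f Y fY X XO by (simp add: hom_def)
    show "k \<in> Arr C \<Longrightarrow> Cod C k = X \<Longrightarrow> ext T Y f \<cdot> eta T X \<cdot> k = f \<cdot> k"
      using Comp_simps(1)[of k "eta T X" "ext T Y f"] f Y fY X XO 1 by simp
  next
    assume g: "g \<in> Arr C" "Z \<in> Obj C" "Cod C g = TO T Z" "Dom C g = Y"
    show 2: "ext T Z g \<cdot> ext T Y f = ext T Z (ext T Z g \<cdot> f)"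
      using ext_ext[of "Dom C f" Y Z f g] f Y fY g by (simp add: hom_def)
    show "k \<in> Arr C \<Longrightarrow> Cod C k = TO T (Dom C f) \<Longrightarrow>
        ext T Z g \<cdot> ext T Y f \<cdot> k = ext T Z (ext T Z g \<cdot> f) \<cdot> k"
      using Comp_simps(1)[of k "ext T Y f" "ext T Z g"] f Y fY g 2 by simp
  }
qed

lemma copair_inl_inr [simp]:
  "X \<in> Obj C \<Longrightarrow> Y \<in> Obj C \<Longrightarrow> copair C (inl C X Y) (inr C X Y) = Id C (X \<oplus> Y)"
  using copair_eta[of "Id C (X \<oplus> Y)" X Y] by simp

section \<open>Eilenberg--Moore algebras as hash algebras\<close>

lemma EM_ext:
  assumes "EM_algebra C T A a" "k \<in> hom C X (TO T A)"
  shows "a \<cdot> ext T A k = a \<cdot> Tmap C T (a \<cdot> k)"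
proof -
  have a: "A \<in> Obj C" "a \<in> Arr C" "Dom C a = TO T A" "Cod C a = A"
    and k: "k \<in> Arr C" "Dom C k = X" "Cod C k = TO T A"
    and *: "a \<cdot> ext T A (eta T A \<cdot> a) = a \<cdot> ext T A (Id C (TO T A))"
    using assms by (auto simp: EM_algebra_def hom_def Tmap_def mu_def)
  \<comment> \<open>Here \<open>ext T A (Id C (TO T A))\<close> is the multiplication at
    \<open>A\<close>. The algebra law \<open>*\<close> replaces it by \<open>Tmap C T a\<close>,
    which then merges with \<open>Tmap C T k\<close>.\<close>
  have "a \<cdot> ext T A k = (a \<cdot> ext T A (Id C (TO T A))) \<cdot> Tmap C T k"
    using a k by (simp add: Tmap_def)
  also have "\<dots> = a \<cdot> Tmap C T (a \<cdot> k)"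
    unfolding *[symmetric] using a k by (simp add: Tmap_def)
  finally show ?thesis .
qed

lemma hash_algebra_EM:
  assumes EM: "EM_algebra C T A a"
  shows "hash_algebra C T A (a \<cdot> Tmap C T (codiag C A))"
proof -
  have a: "A \<in> Obj C" "a \<in> Arr C" "Dom C a = TO T A" "Cod C a = A" "a \<cdot> eta T A = Id C A"
    using EM by (auto simp: EM_algebra_def hom_def)
  show ?thesis
    unfolding hash_algebra_def
    \<comment> \<open>Following \<open>hash_mult\<close> by \<open>Tmap C T (codiag C A)\<close>
      gives the extension of this copairing. By \<open>EM_ext\<close> and the unit law of
      \<open>a\<close>, composing that with \<open>a\<close> yields the other side of the
      multiplication law.\<close>
    using a EM_ext[OF EM, of "copair C (Tmap C T (codiag C A)) (eta T A)" "TO T (A \<oplus> A) \<oplus> A"]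
    by (simp add: hash_obj_def hom_def hash_arr_def hash_unit_def hash_mult_def sum_arr_def
        codiag_def Tmap_def)
qed

text \<open>The right-hand side is the arrow \<open>w\<close> from the last axiom of a weak complete
  Elgot monad, so compositionality for algebras and for monads speaks about the same
  equation.\<close>

lemma elg_square_eq:
  assumes "f \<in> hom C Y (TO T (A \<oplus> Y))" "g \<in> hom C X (TO T (Y \<oplus> X))" "A \<in> Obj C"
  shows "elg_square C T A Y X f g =
    ext T (A \<oplus> (Y \<oplus> X)) (copair C (Tmap C T (sum_arr C (Id C A) (inl C Y X)) \<cdot> f)
      (eta T (A \<oplus> (Y \<oplus> X)) \<cdot> inr C A (Y \<oplus> X) \<cdot> inr C Y X))
    \<cdot> copair C (eta T (Y \<oplus> X) \<cdot> inl C Y X) g"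
proof -
  have "X \<in> Obj C" "Y \<in> Obj C" using assms hom_Obj by blast+
  then show ?thesis
    using assms by (simp add: elg_square_def hash_mult_def hash_arr_def hash_unit_def
        hash_obj_def hom_def sum_arr_def Tmap_def)
qed

section \<open>Iteration on Eilenberg--Moore algebras over a weak complete Elgot monad\<close>

definition EM_sol :: "('o \<Rightarrow> 'm \<Rightarrow> 'm) \<Rightarrow> 'o \<Rightarrow> 'm \<Rightarrow> 'm \<Rightarrow> 'm" where
  "EM_sol dag A a = restrict (\<lambda>e. a \<cdot> dag A e) (\<Union>X\<in>Obj C. hom C X (hash_obj C T A X))"

lemma EM_sol_eq:
  "X \<in> Obj C \<Longrightarrow> e \<in> hom C X (TO T (A \<oplus> X)) \<Longrightarrow> EM_sol dag A a e = a \<cdot> dag A e"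
  by (auto simp: EM_sol_def hash_obj_def)

context
  fixes dag :: "'o \<Rightarrow> 'm \<Rightarrow> 'm"
  assumes weak: "weak_complete_elgot_monad C T dag"
begin

lemma dag_hom:
  "X \<in> Obj C \<Longrightarrow> Y \<in> Obj C \<Longrightarrow> f \<in> hom C X (TO T (Y \<oplus> X)) \<Longrightarrow> dag Y f \<in> hom C X (TO T Y)"
  using weak by (simp add: weak_complete_elgot_monad_def)

lemma dag_fixpoint:
  "X \<in> Obj C \<Longrightarrow> Y \<in> Obj C \<Longrightarrow> f \<in> hom C X (TO T (Y \<oplus> X)) \<Longrightarrow>
     dag Y f = ext T Y (copair C (eta T Y) (dag Y f)) \<cdot> f"
  using weak unfolding weak_complete_elgot_monad_def by blast

lemma dag_uniformity:
  "X \<in> Obj C \<Longrightarrow> Y \<in> Obj C \<Longrightarrow> Z \<in> Obj C \<Longrightarrow> f \<in> hom C X (TO T (Y \<oplus> X)) \<Longrightarrow>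
     g \<in> hom C Z (TO T (Y \<oplus> Z)) \<Longrightarrow> h \<in> hom C Z X \<Longrightarrow>
     f \<cdot> h = Tmap C T (sum_arr C (Id C Y) h) \<cdot> g \<Longrightarrow> dag Y f \<cdot> h = dag Y g"
  using weak unfolding weak_complete_elgot_monad_def by blast

lemma dag_composition:
  assumes "X \<in> Obj C" "Y \<in> Obj C" "Z \<in> Obj C" "g \<in> hom C X (TO T (Y \<oplus> X))"
    "f \<in> hom C Y (TO T (Z \<oplus> Y))"
  shows "dag Z (elg_square C T Z Y X f g) \<cdot> inr C Y X = ext T Z (dag Z f) \<cdot> dag Y g"
proof -
  note weak[unfolded weak_complete_elgot_monad_def Let_def, THEN conjunct2, THEN conjunct2,
      THEN conjunct2, THEN conjunct2, THEN conjunct2]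
  then show ?thesis
    using assms by (simp only: elg_square_eq)
qed

text \<open>This is naturality for \<open>eta T B \<cdot> s\<close>, whose extension is
  \<open>Tmap C T s\<close>.\<close>

lemma dag_Tmap:
  assumes e: "e \<in> hom C X (TO T (A \<oplus> X))" and s: "s \<in> hom C A B"
  shows "dag B (Tmap C T (sum_arr C s (Id C X)) \<cdot> e) = Tmap C T s \<cdot> dag A e"
proof -
  have o: "X \<in> Obj C" "A \<in> Obj C" "B \<in> Obj C" using e s hom_Obj by blast+
  have "ext T B (eta T B \<cdot> s) \<cdot> dag A e = dag B (ext T (B \<oplus> X)
     (copair C (Tmap C T (inl C B X) \<cdot> eta T B \<cdot> s) (eta T (B \<oplus> X) \<cdot> inr C B X)) \<cdot> e)"
    using weak o e Comp_hom[OF s eta_hom] unfolding weak_complete_elgot_monad_def by blast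
  then show ?thesis
    using o e s by (simp add: Tmap_def sum_arr_def hom_def)
qed

text \<open>The equation exits at once through the left summand, so one unfolding of the fixpoint
  leaves the extension of the unit.\<close>

lemma dag_Tmap_inl:
  assumes "A \<in> Obj C"
  shows "dag A (Tmap C T (inl C A (TO T A))) = Id C (TO T A)"
proof -
  have e: "Tmap C T (inl C A (TO T A)) \<in> hom C (TO T A) (TO T (A \<oplus> TO T A))"
    using assms by (intro Tmap_hom inl_hom) auto
  show ?thesis
    using dag_fixpoint[OF _ _ e] dag_hom[OF _ _ e] assms by (simp add: Tmap_def hom_def)
qed

text \<open>Solution comes from the fixpoint law, functoriality from uniformity, and
  compositionality from the composition law together with naturality.\<close>

lemma complete_elgot_algebra_EM:
  assumes EM: "EM_algebra C T A a"
  shows "complete_elgot_algebra C T A (a \<cdot> Tmap C T (codiag C A)) (EM_sol dag A a)"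
proof -
  have a: "A \<in> Obj C" "a \<in> Arr C" "Dom C a = TO T A" "Cod C a = A" "a \<cdot> eta T A = Id C A"
    and a': "a \<in> hom C (TO T A) A"
    using EM by (auto simp: EM_algebra_def hom_def)
  have sol_hom: "a \<cdot> dag A e \<in> hom C X A"
    if "X \<in> Obj C" "e \<in> hom C X (TO T (A \<oplus> X))" for X e
    using dag_hom[OF that(1) a(1) that(2)] a' by (rule Comp_hom)
  have solution: "a \<cdot> dag A e = (a \<cdot> Tmap C T (codiag C A)) \<cdot> hash_arr C T (Id C A) (a \<cdot> dag A e) \<cdot> e"
    if X: "X \<in> Obj C" and e: "e \<in> hom C X (TO T (A \<oplus> X))" for X e
  proof -
    note d = dag_hom[OF X a(1) e]
    have "a \<cdot> dag A e = (a \<cdot> ext T A (copair C (eta T A) (dag A e))) \<cdot> e"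
      using dag_fixpoint[OF X a(1) e] d e X a by (simp add: hom_def)
    \<comment> \<open>Inside \<open>Tmap\<close>, \<open>a\<close> cancels the unit, leaving the
      copairing of the identity with \<open>a \<cdot> dag A e\<close>. This is the codiagonal after
      the sum arrow in the solution law.\<close>
    also have "a \<cdot> ext T A (copair C (eta T A) (dag A e)) =
        a \<cdot> Tmap C T (a \<cdot> copair C (eta T A) (dag A e))"
      by (rule EM_ext[OF EM]) (use d a X in \<open>simp add: hom_def\<close>)
    finally show ?thesis
      using d e X a by (simp add: hom_def hash_arr_def sum_arr_def codiag_def Tmap_def)
  qed
  have functoriality: "(a \<cdot> dag A f) \<cdot> h = a \<cdot> dag A e"
    if "X \<in> Obj C" "Y \<in> Obj C" "e \<in> hom C X (TO T (A \<oplus> X))" "f \<in> hom C Y (TO T (A \<oplus> Y))"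
      "h \<in> hom C X Y" "f \<cdot> h = hash_arr C T (Id C A) h \<cdot> e" for X Y e f h
    using dag_uniformity[OF that(2) a(1) that(1) that(4,3,5)] that(6)
      Comp_assoc[OF that(5) dag_hom[OF that(2) a(1) that(4)] a'] by (simp add: hash_arr_def)
  have square_hom: "elg_square C T A Y X f g \<in> hom C (Y \<oplus> X) (TO T (A \<oplus> (Y \<oplus> X)))"
    if "X \<in> Obj C" "Y \<in> Obj C" "f \<in> hom C Y (TO T (A \<oplus> Y))" "g \<in> hom C X (TO T (Y \<oplus> X))"
    for X Y f g
    using that a by (simp add: elg_square_eq) (simp add: hom_def sum_arr_def Tmap_def)
  have bullet_hom: "elg_bullet C T X (a \<cdot> dag A f) g \<in> hom C X (TO T (A \<oplus> X))"
    if "X \<in> Obj C" "Y \<in> Obj C" "f \<in> hom C Y (TO T (A \<oplus> Y))" "g \<in> hom C X (TO T (Y \<oplus> X))"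
    for X Y f g
    unfolding elg_bullet_def hash_arr_def
    using that by (blast intro: Comp_hom Tmap_hom sum_arr_hom sol_hom Id_hom)
  have compositionality: "(a \<cdot> dag A (elg_square C T A Y X f g)) \<cdot> inr C Y X =
      a \<cdot> dag A (elg_bullet C T X (a \<cdot> dag A f) g)"
    if X: "X \<in> Obj C" and Y: "Y \<in> Obj C" and f: "f \<in> hom C Y (TO T (A \<oplus> Y))"
      and g: "g \<in> hom C X (TO T (Y \<oplus> X))" for X Y f g
  proof -
    note df = dag_hom[OF Y a(1) f] and dg = dag_hom[OF X Y g]
    have "(a \<cdot> dag A (elg_square C T A Y X f g)) \<cdot> inr C Y X =
        a \<cdot> ext T A (dag A f) \<cdot> dag Y g"
      using dag_hom[OF _ a(1) square_hom[OF X Y f g]] dag_composition[OF X Y a(1) g f] X Y a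
      by (simp add: hom_def)
    \<comment> \<open>Once the extension has become a \<open>Tmap\<close>, \<open>dag_Tmap\<close>
      can move it inside the iteration of \<open>g\<close>, where it forms
      \<open>elg_bullet\<close>.\<close>
    also have "\<dots> = (a \<cdot> Tmap C T (a \<cdot> dag A f)) \<cdot> dag Y g"
      using EM_ext[OF EM df] Comp_assoc[OF dg ext_hom[OF Y a(1) df] a'] by simp
    also have "\<dots> = a \<cdot> dag A (elg_bullet C T X (a \<cdot> dag A f) g)"
      using dag_Tmap[OF g sol_hom[OF Y f]]
        Comp_assoc[OF dg Tmap_hom[OF sol_hom[OF Y f]] a']
      by (simp add: elg_bullet_def hash_arr_def)
    finally show ?thesis .
  qed
  have "EM_sol dag A a \<in> extensional (\<Union>X\<in>Obj C. hom C X (hash_obj C T A X))"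
    by (simp add: EM_sol_def)
  moreover have "EM_sol dag A a (elg_square C T A Y X f g) \<cdot> inr C Y X =
      EM_sol dag A a (elg_bullet C T X (EM_sol dag A a f) g)"
    if "X \<in> Obj C" "Y \<in> Obj C" "f \<in> hom C Y (TO T (A \<oplus> Y))" "g \<in> hom C X (TO T (Y \<oplus> X))"
    for X Y f g
    using that compositionality[OF that] EM_sol_eq[OF _ square_hom[OF that]]
      EM_sol_eq[OF _ bullet_hom[OF that]] by (simp add: EM_sol_eq)
  ultimately show ?thesis
    using hash_algebra_EM[OF EM] sol_hom solution functoriality
    unfolding complete_elgot_algebra_def
    by (auto simp: hash_obj_def EM_sol_eq)
qed

text \<open>As the codiagonal after \<open>inl\<close> is the identity, \<open>b\<close> equals
  \<open>a \<cdot> Tmap C T (inl C A A)\<close>. The laws of \<open>b\<close> are therefore those of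
  \<open>a\<close> restricted along left injections, and the two iteration operators agree.\<close>

lemma EM_of_complete_elgot_algebra:
  assumes alg: "complete_elgot_algebra C T A a sol"
    and b: "b \<in> hom C (TO T A) A" "a = b \<cdot> Tmap C T (codiag C A)"
    and sol: "\<And>X e. X \<in> Obj C \<Longrightarrow> e \<in> hom C X (TO T (A \<oplus> X)) \<Longrightarrow>
      sol e = a \<cdot> Tmap C T (inl C A A) \<cdot> dag A e"
  shows "EM_algebra C T A b" "EM_sol dag A b = sol"
proof -
  have hash: "hash_algebra C T A a" using alg by (simp add: complete_elgot_algebra_def)
  have A: "A \<in> Obj C" and unit: "a \<cdot> hash_unit C T A A = Id C A"
    and mult: "a \<cdot> hash_arr C T a (Id C A) = a \<cdot> hash_mult C T A A"
    using hash by (auto simp: hash_algebra_def)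
  have bs: "b \<in> Arr C" "Dom C b = TO T A" "Cod C b = A" using b(1) by (auto simp: hom_def)
  have "b \<cdot> eta T A = Id C A"
    using unit A bs by (simp add: b(2) hash_unit_def Tmap_def codiag_def)
  moreover have "b \<cdot> Tmap C T b = b \<cdot> mu C T A"
  proof -
    \<comment> \<open>This arrow embeds \<open>TO T (TO T A)\<close> by left injections at both
      levels. Along it the two sides of the hash multiplication law become
      \<open>b \<cdot> Tmap C T b\<close> and \<open>b \<cdot> mu C T A\<close>.\<close>
    let ?k = "Tmap C T (inl C (TO T (A \<oplus> A)) A \<cdot> Tmap C T (inl C A A))"
    have "b \<cdot> Tmap C T b = (a \<cdot> hash_arr C T a (Id C A)) \<cdot> ?k"
      using A bs by (simp add: b(2) hash_arr_def sum_arr_def Tmap_def codiag_def)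
    also have "\<dots> = b \<cdot> mu C T A"
      unfolding mult
      using A bs by (simp add: b(2) hash_mult_def hash_obj_def mu_def Tmap_def codiag_def)
    finally show ?thesis .
  qed
  ultimately show "EM_algebra C T A b" using A b by (simp add: EM_algebra_def)
  show "EM_sol dag A b = sol"
  proof (rule extensionalityI)
    show "EM_sol dag A b \<in> extensional (\<Union>X\<in>Obj C. hom C X (hash_obj C T A X))"
      by (simp add: EM_sol_def)
    show "sol \<in> extensional (\<Union>X\<in>Obj C. hom C X (hash_obj C T A X))"
      using alg by (simp add: complete_elgot_algebra_def)
    fix e assume "e \<in> (\<Union>X\<in>Obj C. hom C X (hash_obj C T A X))"
    then obtain X where X: "X \<in> Obj C" and e: "e \<in> hom C X (TO T (A \<oplus> X))"
      by (auto simp: hash_obj_def)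
    show "EM_sol dag A b e = sol e"
      using EM_sol_eq[OF X e] sol[OF X e] dag_hom[OF X A e] A bs
      by (simp add: hom_def b(2) Tmap_def codiag_def)
  qed
qed

text \<open>Every algebra structure is itself an iterate, namely of \<open>T inl : TA \<rightarrow> T(A + TA)\<close>;
  hence preservation of iteration forces preservation of the structure.\<close>

lemma EM_hom_iff_preserves_EM_sol:
  assumes EM: "EM_algebra C T A a" "EM_algebra C T B b" and f: "f \<in> hom C A B"
  shows "(\<forall>X\<in>Obj C. \<forall>e\<in>hom C X (hash_obj C T A X).
      EM_sol dag B b (hash_arr C T f (Id C X) \<cdot> e) = f \<cdot> EM_sol dag A a e) \<longleftrightarrow>
    f \<cdot> a = b \<cdot> Tmap C T f" (is "?L \<longleftrightarrow> _")
proof -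
  have a: "a \<in> hom C (TO T A) A" and b: "b \<in> hom C (TO T B) B"
    and A: "A \<in> Obj C" and B: "B \<in> Obj C"
    using EM by (auto simp: EM_algebra_def)
  have *: "EM_sol dag B b (hash_arr C T f (Id C X) \<cdot> e) = (b \<cdot> Tmap C T f) \<cdot> dag A e"
    "f \<cdot> EM_sol dag A a e = (f \<cdot> a) \<cdot> dag A e"
    if X: "X \<in> Obj C" and e: "e \<in> hom C X (TO T (A \<oplus> X))" for X e
  proof -
    have "Tmap C T (sum_arr C f (Id C X)) \<cdot> e \<in> hom C X (TO T (B \<oplus> X))"
      using X e f by (blast intro: Comp_hom Tmap_hom sum_arr_hom Id_hom)
    then show "EM_sol dag B b (hash_arr C T f (Id C X) \<cdot> e) = (b \<cdot> Tmap C T f) \<cdot> dag A e"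
      using EM_sol_eq[OF X] dag_Tmap[OF e f] Comp_assoc[OF dag_hom[OF X A e] Tmap_hom[OF f] b]
      by (simp add: hash_arr_def)
    show "f \<cdot> EM_sol dag A a e = (f \<cdot> a) \<cdot> dag A e"
      using EM_sol_eq[OF X e] Comp_assoc[OF dag_hom[OF X A e] a f] by simp
  qed
  show ?thesis
  proof
    assume ?L
    have TA: "TO T A \<in> Obj C" using A by simp
    have e: "Tmap C T (inl C A (TO T A)) \<in> hom C (TO T A) (TO T (A \<oplus> TO T A))"
      using A by (intro Tmap_hom inl_hom) auto
    from \<open>?L\<close> TA e have "EM_sol dag B b (hash_arr C T f (Id C (TO T A)) \<cdot> Tmap C T (inl C A (TO T A)))
        = f \<cdot> EM_sol dag A a (Tmap C T (inl C A (TO T A)))"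
      unfolding hash_obj_def by blast
    then have "(b \<cdot> Tmap C T f) \<cdot> Id C (TO T A) = (f \<cdot> a) \<cdot> Id C (TO T A)"
      unfolding *[OF TA e] dag_Tmap_inl[OF A] .
    then show "f \<cdot> a = b \<cdot> Tmap C T f"
      using Id_right[OF Comp_hom[OF a f]] Id_right[OF Comp_hom[OF Tmap_hom[OF f] b]] by simp
  next
    assume "f \<cdot> a = b \<cdot> Tmap C T f"
    then show ?L using * by (simp add: hash_obj_def)
  qed
qed

text \<open>The object map sends \<open>a\<close> to \<open>a \<cdot> Tmap C T (codiag C A)\<close>
  with \<open>EM_sol\<close>. It is injective because \<open>Tmap C T (inl C A A)\<close> recovers
  \<open>a\<close>, and surjective by \<open>EM_of_complete_elgot_algebra\<close>. Morphisms
  correspond by \<open>EM_hom_iff_preserves_EM_sol\<close>.\<close>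

lemma EM_isomorphic_elgot_algebras:
  "isomorphic_categories (EM C T)
    (full_subcategory (CElg C T)
      {(A, a, sol). complete_elgot_algebra C T A a sol \<and>
         (\<exists>b\<in>hom C (TO T A) A. a = b \<cdot> Tmap C T (codiag C A)) \<and>
         (\<forall>X\<in>Obj C. \<forall>e\<in>hom C X (TO T (A \<oplus> X)).
            sol e = a \<cdot> Tmap C T (inl C A A) \<cdot> dag A e)})"
    (is "isomorphic_categories _ (full_subcategory _ ?S)")
proof -
  let ?F = "\<lambda>(A, a). (A, a \<cdot> Tmap C T (codiag C A), EM_sol dag A a)"
  have sub: "?S \<inter> {(A, a, sol). complete_elgot_algebra C T A a sol} = ?S" by blast
  have codiag_inl: "(b \<cdot> Tmap C T (codiag C A)) \<cdot> Tmap C T (inl C A A) = b"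
    if "b \<in> hom C (TO T A) A" for A b
    using that hom_Obj[OF that] by (auto simp: hom_def Tmap_def codiag_def)
  have "bij_betw ?F {(A, a). EM_algebra C T A a} ?S"
  proof (rule bij_betw_imageI)
    show "inj_on ?F {(A, a). EM_algebra C T A a}"
      by (rule inj_onI) (auto simp: EM_algebra_def, metis codiag_inl)
    show "?F ` {(A, a). EM_algebra C T A a} = ?S"
    proof (intro subset_antisym subsetI)
      fix y assume "y \<in> ?F ` {(A, a). EM_algebra C T A a}"
      then obtain A a where EM: "EM_algebra C T A a"
        and y: "y = (A, a \<cdot> Tmap C T (codiag C A), EM_sol dag A a)" by auto
      have a: "a \<in> hom C (TO T A) A" and A: "A \<in> Obj C" using EM by (auto simp: EM_algebra_def)
      have "EM_sol dag A a e =
          (a \<cdot> Tmap C T (codiag C A)) \<cdot> Tmap C T (inl C A A) \<cdot> dag A e"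
        if X: "X \<in> Obj C" and e: "e \<in> hom C X (TO T (A \<oplus> X))" for X e
        using EM_sol_eq[OF X e] dag_hom[OF X A e] A a by (simp add: hom_def Tmap_def codiag_def)
      then show "y \<in> ?S"
        using complete_elgot_algebra_EM[OF EM] a by (auto simp: y)
    next
      fix y assume "y \<in> ?S"
      then obtain A a sol b where y: "y = (A, a, sol)" and alg: "complete_elgot_algebra C T A a sol"
        and b: "b \<in> hom C (TO T A) A" "a = b \<cdot> Tmap C T (codiag C A)"
        and sol: "\<forall>X\<in>Obj C. \<forall>e\<in>hom C X (TO T (A \<oplus> X)).
            sol e = a \<cdot> Tmap C T (inl C A A) \<cdot> dag A e"
        by auto
      have "EM_algebra C T A b" "EM_sol dag A b = sol"
        using EM_of_complete_elgot_algebra[OF alg b] sol by blast+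
      then have "y = ?F (A, b)" "(A, b) \<in> {(A, a). EM_algebra C T A a}" using y b(2) by auto
      then show "y \<in> ?F ` {(A, a). EM_algebra C T A a}" by (rule image_eqI)
    qed
  qed
  moreover have "category (full_subcategory (CElg C T) ?S)"
    using category_CElg[OF finite_coproducts_axioms kleisli_triple_axioms]
    by (rule category_full_subcategory)
  ultimately show ?thesis
    using category_EM
    unfolding EM_def CElg_def full_subcategory_structured_cat sub
    by (intro isomorphic_structured_cats[where F = ?F])
      (simp_all add: split_beta EM_hom_iff_preserves_EM_sol)
qed

end

section \<open>Free algebras, and iteration in a complete Elgot algebra with structure
  \<open>a \<cdot> Tmap C T (codiag C A)\<close>\<close>

lemma EM_algebra_free: "Y \<in> Obj C \<Longrightarrow> EM_algebra C T (TO T Y) (mu C T Y)"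
  by (simp add: EM_algebra_def hom_def mu_def Tmap_def)

text \<open>This is what allows the functor of part (ii) to be applied to Kleisli
  extensions.\<close>

lemma ext_EM_hom:
  "g \<in> hom C Y (TO T Z) \<Longrightarrow> Z \<in> Obj C \<Longrightarrow>
    ext T Z g \<cdot> mu C T Y = mu C T Z \<cdot> Tmap C T (ext T Z g)"
  using hom_Obj by (auto simp: hom_def mu_def Tmap_def)

lemma Obj_EM: "(A, a) \<in> Obj (EM C T) \<longleftrightarrow> EM_algebra C T A a"
  by (simp add: EM_def structured_cat_def)

lemma Obj_CElg: "(A, a, sol) \<in> Obj (CElg C T) \<longleftrightarrow> complete_elgot_algebra C T A a sol"
  by (simp add: CElg_def structured_cat_def)

context
  fixes A a sol
  assumes elgot: "complete_elgot_algebra C T A (a \<cdot> Tmap C T (codiag C A)) sol"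
    and structure_hom: "a \<in> hom C (TO T A) A"
begin

lemma structure_simps:
  "A \<in> Obj C" "a \<in> Arr C" "Dom C a = TO T A" "Cod C a = A"
  using structure_hom hom_Obj by (auto simp: hom_def)

lemma sol_hom: "e \<in> hom C X (TO T (A \<oplus> X)) \<Longrightarrow> sol e \<in> hom C X A"
  using elgot hom_Obj(1)[of e] unfolding complete_elgot_algebra_def hash_obj_def by blast

lemma sol_solution:
  assumes e: "e \<in> hom C X (TO T (A \<oplus> X))"
  shows "sol e = a \<cdot> Tmap C T (copair C (Id C A) (sol e)) \<cdot> e"
proof -
  have X: "X \<in> Obj C" using hom_Obj e by blast
  have "sol e = (a \<cdot> Tmap C T (codiag C A)) \<cdot> hash_arr C T (Id C A) (sol e) \<cdot> e"
    using elgot e X unfolding complete_elgot_algebra_def hash_obj_def by blast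
  also have "\<dots> = a \<cdot> Tmap C T (copair C (Id C A) (sol e)) \<cdot> e"
    using X structure_simps e sol_hom[OF e]
    by (simp add: hom_def codiag_def hash_arr_def sum_arr_def Tmap_def)
  finally show ?thesis .
qed

lemma sol_functoriality:
  assumes "e \<in> hom C X (TO T (A \<oplus> X))" "f \<in> hom C Y (TO T (A \<oplus> Y))" "h \<in> hom C X Y"
    "f \<cdot> h = Tmap C T (sum_arr C (Id C A) h) \<cdot> e"
  shows "sol f \<cdot> h = sol e"
  using elgot assms hom_Obj[OF assms(3)]
  unfolding complete_elgot_algebra_def hash_obj_def hash_arr_def by blast

lemma sol_compositionality:
  assumes "f \<in> hom C Y (TO T (A \<oplus> Y))" "g \<in> hom C X (TO T (Y \<oplus> X))"
  shows "sol (elg_square C T A Y X f g) \<cdot> inr C Y X =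
    sol (Tmap C T (sum_arr C (sol f) (Id C X)) \<cdot> g)"
  using elgot assms hom_Obj(1)[OF assms(1)] hom_Obj(1)[OF assms(2)]
  unfolding complete_elgot_algebra_def hash_obj_def elg_bullet_def hash_arr_def by blast

text \<open>The equation never enters its right summand, so one unfolding computes the solution. For
  \<open>k\<close> the identity of \<open>TO T A\<close> the solution is \<open>a\<close>
  itself.\<close>

lemma sol_Tmap_inl:
  assumes k: "k \<in> hom C X (TO T A)"
  shows "sol (Tmap C T (inl C A X) \<cdot> k) = a \<cdot> k"
proof -
  have X: "X \<in> Obj C" using hom_Obj k by blast
  have e: "Tmap C T (inl C A X) \<cdot> k \<in> hom C X (TO T (A \<oplus> X))"
    using k X structure_simps(1) by (blast intro: Comp_hom Tmap_hom inl_hom)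
  show ?thesis
    using sol_solution[OF e] sol_hom[OF e] X structure_simps k by (simp add: hom_def Tmap_def)
qed

text \<open>Compositionality applied to \<open>T inl : TA \<rightarrow> T(A + TA)\<close>, whose solution is \<open>a\<close>, lets one
  exchange evaluation by \<open>a\<close> for monad multiplication inside an iteration.\<close>

lemma sol_flatten:
  assumes e: "e \<in> hom C X (TO T (TO T A \<oplus> X))"
  shows "sol (Tmap C T (sum_arr C a (Id C X)) \<cdot> e) =
    sol (ext T (A \<oplus> X) (copair C (Tmap C T (inl C A X)) (eta T (A \<oplus> X) \<cdot> inr C A X)) \<cdot> e)"
    (is "_ = sol ?e'")
proof -
  have X: "X \<in> Obj C" using hom_Obj e by blast
  note simps = X structure_simps
  let ?f = "Tmap C T (inl C A (TO T A))"
  have f: "?f \<in> hom C (TO T A) (TO T (A \<oplus> TO T A))"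
    using simps by (intro Tmap_hom inl_hom) auto
  have "sol ?f = a"
    using sol_Tmap_inl[OF Id_hom] simps f by (simp add: hom_def)
  then have "sol (Tmap C T (sum_arr C a (Id C X)) \<cdot> e) =
      sol (elg_square C T A (TO T A) X ?f e) \<cdot> inr C (TO T A) X"
    using sol_compositionality[OF f e] by simp
  \<comment> \<open>\<open>inr\<close> is a morphism of equations from \<open>?e'\<close> to the
    square: started in \<open>X\<close>, the square runs \<open>e\<close>, expands each result in
    \<open>TO T A\<close> into results in \<open>A\<close>, and sends recursive calls back to
    \<open>X\<close>.\<close>
  also have "\<dots> = sol ?e'"
  proof (rule sol_functoriality)
    show "?e' \<in> hom C X (TO T (A \<oplus> X))"
      using simps e by (simp add: hom_def Tmap_def)
    show "elg_square C T A (TO T A) X ?f e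
        \<in> hom C (TO T A \<oplus> X) (TO T (A \<oplus> TO T A \<oplus> X))"
      unfolding elg_square_eq[OF f e simps(2)]
      using simps e by (simp add: hom_def Tmap_def sum_arr_def)
    show "inr C (TO T A) X \<in> hom C X (TO T A \<oplus> X)"
      using simps by (simp add: hom_def)
    show "elg_square C T A (TO T A) X ?f e \<cdot> inr C (TO T A) X =
        Tmap C T (sum_arr C (Id C A) (inr C (TO T A) X)) \<cdot> ?e'"
      unfolding elg_square_eq[OF f e simps(2)]
      using simps e by (simp add: hom_def Tmap_def sum_arr_def)
  qed
  finally show ?thesis .
qed

end

section \<open>The iteration operator on \<open>T\<close> induced by a functor into complete Elgot
  algebras\<close>

context
  fixes Jo :: "'o \<times> 'm \<Rightarrow> 'o \<times> 'm \<times> ('m \<Rightarrow> 'm)"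
    and Jm :: "('o \<times> 'm) \<times> ('o \<times> 'm) \<times> 'm \<Rightarrow>
      ('o \<times> 'm \<times> ('m \<Rightarrow> 'm)) \<times> ('o \<times> 'm \<times> ('m \<Rightarrow> 'm)) \<times> 'm"
  assumes J: "cat_functor (EM C T) (CElg C T) Jo Jm"
    and J_objects: "\<forall>(A, a)\<in>Obj (EM C T). \<exists>sol. Jo (A, a) = (A, a \<cdot> Tmap C T (codiag C A), sol)"
    and J_arrows: "\<forall>(x, y, f)\<in>Arr (EM C T). Jm (x, y, f) = (Jo x, Jo y, f)"
begin

definition J_sol :: "'o \<Rightarrow> 'm \<Rightarrow> 'm \<Rightarrow> 'm" where
  "J_sol A a = snd (snd (Jo (A, a)))"

lemma Jo_eq:
  "EM_algebra C T A a \<Longrightarrow> Jo (A, a) = (A, a \<cdot> Tmap C T (codiag C A), J_sol A a)"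
  using J_objects by (force simp: J_sol_def Obj_EM)

lemma J_sol_elgot:
  "EM_algebra C T A a \<Longrightarrow>
    complete_elgot_algebra C T A (a \<cdot> Tmap C T (codiag C A)) (J_sol A a)"
  using cat_functor.Fo_Obj[OF J, of "(A, a)"] by (simp add: Obj_EM Jo_eq Obj_CElg)

text \<open>\<open>Jm\<close> keeps underlying arrows and lands in \<open>CElg\<close>, so every
  algebra homomorphism preserves iteration.\<close>

lemma J_sol_natural:
  assumes EM: "EM_algebra C T A a" "EM_algebra C T B b"
    and f: "f \<in> hom C A B" "f \<cdot> a = b \<cdot> Tmap C T f"
    and e: "e \<in> hom C X (TO T (A \<oplus> X))"
  shows "J_sol B b (Tmap C T (sum_arr C f (Id C X)) \<cdot> e) = f \<cdot> J_sol A a e"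
proof -
  have F: "((A, a), (B, b), f) \<in> hom (EM C T) (A, a) (B, b)"
    using EM f by (simp add: EM_def hom_structured_cat)
  then have "Jm ((A, a), (B, b), f) = (Jo (A, a), Jo (B, b), f)"
    using J_arrows by (auto simp: hom_def)
  with cat_functor.Fm_hom[OF J F]
  have "(Jo (A, a), Jo (B, b), f) \<in> hom (CElg C T) (Jo (A, a)) (Jo (B, b))" by simp
  then show ?thesis
    using e hom_Obj(1)[OF e]
    by (simp add: CElg_def hom_structured_cat Jo_eq EM hash_obj_def hash_arr_def)
qed

text \<open>The body has the form required in the theorem, so unfolding it gives that statement;
  \<open>J_dag_eq\<close> is the form used in proofs.\<close>

definition J_dag :: "'o \<Rightarrow> 'm \<Rightarrow> 'm" where
  "J_dag Y e = (case Jo (TO T Y, mu C T Y) of (_, _, sol) \<Rightarrow>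
     sol (Tmap C T (sum_arr C (eta T Y) (Id C (Dom C e))) \<cdot> e))"

lemma J_dag_eq:
  "e \<in> hom C X (TO T (Y \<oplus> X)) \<Longrightarrow>
    J_dag Y e = J_sol (TO T Y) (mu C T Y) (Tmap C T (sum_arr C (eta T Y) (Id C X)) \<cdot> e)"
  by (auto simp: J_dag_def J_sol_def hom_def split_beta)

lemma weak_complete_elgot_monad_J_dag: "weak_complete_elgot_monad C T J_dag"
proof -
  note elgot = J_sol_elgot[OF EM_algebra_free]
  have mu: "mu C T Y \<in> hom C (TO T (TO T Y)) (TO T Y)" if "Y \<in> Obj C" for Y
    using EM_algebra_free[OF that] by (simp add: EM_algebra_def)
  have eta_e: "Tmap C T (sum_arr C (eta T Y) (Id C X)) \<cdot> e \<in> hom C X (TO T (TO T Y \<oplus> X))"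
    if "X \<in> Obj C" "Y \<in> Obj C" "e \<in> hom C X (TO T (Y \<oplus> X))" for X Y e
    using that by (blast intro: Comp_hom Tmap_hom sum_arr_hom Id_hom eta_hom)
  have dag_hom: "J_dag Y e \<in> hom C X (TO T Y)"
    if "X \<in> Obj C" "Y \<in> Obj C" "e \<in> hom C X (TO T (Y \<oplus> X))" for X Y e
    unfolding J_dag_eq[OF that(3)]
    using sol_hom[OF elgot mu eta_e] that by blast
  have fixpoint: "J_dag Y e = ext T Y (copair C (eta T Y) (J_dag Y e)) \<cdot> e"
    if X: "X \<in> Obj C" and Y: "Y \<in> Obj C" and e: "e \<in> hom C X (TO T (Y \<oplus> X))" for X Y e
  proof -
    have "J_dag Y e = mu C T Y \<cdot> Tmap C T (copair C (Id C (TO T Y)) (J_dag Y e))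
        \<cdot> Tmap C T (sum_arr C (eta T Y) (Id C X)) \<cdot> e"
      using sol_solution[OF elgot[OF Y] mu[OF Y] eta_e[OF X Y e]] by (simp add: J_dag_eq[OF e])
    also have "\<dots> = ext T Y (copair C (eta T Y) (J_dag Y e)) \<cdot> e"
      using dag_hom[OF X Y e] X Y e by (simp add: hom_def mu_def Tmap_def sum_arr_def)
    finally show ?thesis .
  qed
  \<comment> \<open>An extension is a homomorphism of free algebras, so it moves inside the
    iteration and there absorbs the unit, leaving \<open>g\<close>. Both naturality and composition
    rest on this.\<close>
  have ext_dag: "ext T Z g \<cdot> J_dag Y f =
      J_sol (TO T Z) (mu C T Z) (Tmap C T (sum_arr C g (Id C X)) \<cdot> f)"
    if X: "X \<in> Obj C" and Y: "Y \<in> Obj C" and Z: "Z \<in> Obj C"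
      and f: "f \<in> hom C X (TO T (Y \<oplus> X))" and g: "g \<in> hom C Y (TO T Z)" for X Y Z f g
  proof -
    have "ext T Z g \<cdot> J_dag Y f = J_sol (TO T Z) (mu C T Z)
        (Tmap C T (sum_arr C (ext T Z g) (Id C X)) \<cdot> Tmap C T (sum_arr C (eta T Y) (Id C X)) \<cdot> f)"
      unfolding J_dag_eq[OF f]
      by (rule J_sol_natural[symmetric]) (intro EM_algebra_free ext_hom ext_EM_hom eta_e X Y Z f g)+
    also have "Tmap C T (sum_arr C (ext T Z g) (Id C X)) \<cdot> Tmap C T (sum_arr C (eta T Y) (Id C X)) \<cdot> f
        = Tmap C T (sum_arr C g (Id C X)) \<cdot> f"
      using X Y Z f g by (simp add: hom_def Tmap_def sum_arr_def)
    finally show ?thesis .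
  qed
  have naturality: "ext T Z g \<cdot> J_dag Y f = J_dag Z (ext T (Z \<oplus> X)
      (copair C (Tmap C T (inl C Z X) \<cdot> g) (eta T (Z \<oplus> X) \<cdot> inr C Z X)) \<cdot> f)"
    (is "_ = J_dag Z ?f'")
    if X: "X \<in> Obj C" and Y: "Y \<in> Obj C" and Z: "Z \<in> Obj C"
      and f: "f \<in> hom C X (TO T (Y \<oplus> X))" and g: "g \<in> hom C Y (TO T Z)" for X Y Z f g
  proof -
    \<comment> \<open>The inserted \<open>Tmap C T (eta T Z)\<close> is cancelled by
      \<open>mu C T Z\<close>, which brings the right-hand side of \<open>ext_dag\<close> into the
      shape needed by \<open>sol_flatten\<close>. Flattening instead of evaluating then leaves
      \<open>?f'\<close> with the unit inserted.\<close>
    let ?e = "Tmap C T (sum_arr C (Tmap C T (eta T Z) \<cdot> g) (Id C X)) \<cdot> f"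
    have e: "?e \<in> hom C X (TO T (TO T (TO T Z) \<oplus> X))"
      using X Y Z f g by (simp add: hom_def Tmap_def sum_arr_def)
    have f': "?f' \<in> hom C X (TO T (Z \<oplus> X))"
      using X Y Z f g by (simp add: hom_def Tmap_def sum_arr_def)
    have "ext T Z g \<cdot> J_dag Y f =
        J_sol (TO T Z) (mu C T Z) (Tmap C T (sum_arr C (mu C T Z) (Id C X)) \<cdot> ?e)"
      unfolding ext_dag[OF that]
      using X Y Z f g by (simp add: hom_def Tmap_def sum_arr_def mu_def)
    also have "\<dots> = J_dag Z ?f'"
      unfolding sol_flatten[OF elgot[OF Z] mu[OF Z] e] J_dag_eq[OF f']
      using X Y Z f g by (simp add: hom_def Tmap_def sum_arr_def)
    finally show ?thesis .
  qed
  have uniformity: "J_dag Y f \<cdot> h = J_dag Y g"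
    if X: "X \<in> Obj C" and Y: "Y \<in> Obj C" and Z: "Z \<in> Obj C"
      and f: "f \<in> hom C X (TO T (Y \<oplus> X))" and g: "g \<in> hom C Z (TO T (Y \<oplus> Z))"
      and h: "h \<in> hom C Z X" and eq: "f \<cdot> h = Tmap C T (sum_arr C (Id C Y) h) \<cdot> g" for X Y Z f g h
    unfolding J_dag_eq[OF f] J_dag_eq[OF g]
  proof (rule sol_functoriality[OF elgot[OF Y] mu[OF Y] eta_e[OF Z Y g] eta_e[OF X Y f] h])
    \<comment> \<open>The unit and \<open>h\<close> act on different summands, so \<open>h\<close>
      is still a morphism of equations after the unit is inserted.\<close>
    have "(Tmap C T (sum_arr C (eta T Y) (Id C X)) \<cdot> f) \<cdot> h =
        Tmap C T (sum_arr C (eta T Y) (Id C X)) \<cdot> Tmap C T (sum_arr C (Id C Y) h) \<cdot> g"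
      unfolding eq[symmetric] using X Y f h by (simp add: hom_def Tmap_def sum_arr_def)
    also have "\<dots> = Tmap C T (sum_arr C (Id C (TO T Y)) h)
        \<cdot> Tmap C T (sum_arr C (eta T Y) (Id C Z)) \<cdot> g"
      using X Y Z g h by (simp add: hom_def Tmap_def sum_arr_def)
    finally show "(Tmap C T (sum_arr C (eta T Y) (Id C X)) \<cdot> f) \<cdot> h = \<dots>" .
  qed
  have composition: "J_dag Z w \<cdot> inr C Y X = ext T Z (J_dag Z f) \<cdot> J_dag Y g"
    if X: "X \<in> Obj C" and Y: "Y \<in> Obj C" and Z: "Z \<in> Obj C"
      and g: "g \<in> hom C X (TO T (Y \<oplus> X))" and f: "f \<in> hom C Y (TO T (Z \<oplus> Y))"
      and w: "w = ext T (Z \<oplus> (Y \<oplus> X))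
        (copair C (Tmap C T (sum_arr C (Id C Z) (inl C Y X)) \<cdot> f)
          (eta T (Z \<oplus> (Y \<oplus> X)) \<cdot> inr C Z (Y \<oplus> X) \<cdot> inr C Y X))
        \<cdot> copair C (eta T (Y \<oplus> X) \<cdot> inl C Y X) g" for X Y Z f g w
  proof -
    let ?f = "Tmap C T (sum_arr C (eta T Z) (Id C Y)) \<cdot> f"
    have w_hom: "w \<in> hom C (Y \<oplus> X) (TO T (Z \<oplus> (Y \<oplus> X)))"
      unfolding w using X Y Z f g by (simp add: hom_def Tmap_def sum_arr_def)
    \<comment> \<open>Every exit of \<open>w\<close> into \<open>Z\<close> comes from
      \<open>f\<close>, so inserting the unit into \<open>w\<close> amounts to inserting it into
      \<open>f\<close> alone.\<close>
    have "Tmap C T (sum_arr C (eta T Z) (Id C (Y \<oplus> X))) \<cdot> w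
        = elg_square C T (TO T Z) Y X ?f g"
      unfolding elg_square_eq[OF eta_e[OF Y Z f] g TO_Obj[OF Z]] w
      using X Y Z f g by (simp add: hom_def Tmap_def sum_arr_def)
    then have "J_dag Z w \<cdot> inr C Y X =
        J_sol (TO T Z) (mu C T Z) (Tmap C T (sum_arr C (J_dag Z f) (Id C X)) \<cdot> g)"
      unfolding J_dag_eq[OF w_hom] J_dag_eq[OF f]
      using sol_compositionality[OF elgot[OF Z] mu[OF Z] eta_e[OF Y Z f] g] by simp
    also have "\<dots> = ext T Z (J_dag Z f) \<cdot> J_dag Y g"
      by (rule ext_dag[OF X Y Z g dag_hom[OF Y Z f], symmetric])
    finally show ?thesis .
  qed
  show ?thesis
    unfolding weak_complete_elgot_monad_def Let_def
    by (intro conjI ballI impI kleisli_triple_axioms)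
      (blast intro: dag_hom fixpoint naturality uniformity composition[OF _ _ _ _ _ refl])+
qed

lemmas weak_complete_elgot_monad_J = weak_complete_elgot_monad_J_dag[unfolded J_dag_def[abs_def]]

lemma full_J: "full_functor (EM C T) (CElg C T) Jo Jm"
  unfolding full_functor_def
proof (intro ballI)
  fix x y g
  assume "x \<in> Obj (EM C T)" "y \<in> Obj (EM C T)" and g: "g \<in> hom (CElg C T) (Jo x) (Jo y)"
  then obtain A a B b where x: "x = (A, a)" and y: "y = (B, b)"
    and EM: "EM_algebra C T A a" "EM_algebra C T B b"
    by (metis Obj_EM surj_pair)
  have a: "a \<in> hom C (TO T A) A" and b: "b \<in> hom C (TO T B) B"
    and A: "A \<in> Obj C" and B: "B \<in> Obj C"
    using EM by (auto simp: EM_algebra_def)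
  from g obtain f where g_eq: "g = (Jo x, Jo y, f)" and f: "f \<in> hom C A B"
    and preserves: "\<And>X e. X \<in> Obj C \<Longrightarrow> e \<in> hom C X (TO T (A \<oplus> X)) \<Longrightarrow>
      J_sol B b (Tmap C T (sum_arr C f (Id C X)) \<cdot> e) = f \<cdot> J_sol A a e"
    by (auto simp: CElg_def hom_structured_cat x y Jo_eq EM hash_obj_def hash_arr_def)
  let ?e = "Tmap C T (inl C A (TO T A))"
  have e: "?e \<in> hom C (TO T A) (TO T (A \<oplus> TO T A))"
    using A by (intro Tmap_hom inl_hom) auto
  \<comment> \<open>On \<open>A\<close> the equation \<open>?e\<close> has solution
    \<open>a\<close>; transported along \<open>f\<close> it has solution
    \<open>b \<cdot> Tmap C T f\<close> on \<open>B\<close>. Preservation of this one iteration is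
    the homomorphism law.\<close>
  have "Tmap C T (sum_arr C f (Id C (TO T A))) \<cdot> ?e = Tmap C T (inl C B (TO T A)) \<cdot> Tmap C T f"
    using A B f by (simp add: hom_def Tmap_def sum_arr_def)
  then have "b \<cdot> Tmap C T f = f \<cdot> J_sol A a (?e \<cdot> Id C (TO T A))"
    using preserves[OF TO_Obj[OF A] e] Id_right[OF e]
      sol_Tmap_inl[OF J_sol_elgot[OF EM(2)] b Tmap_hom[OF f]] by simp
  then have "f \<cdot> a = b \<cdot> Tmap C T f"
    using sol_Tmap_inl[OF J_sol_elgot[OF EM(1)] a Id_hom[OF TO_Obj[OF A]]] Id_right[OF a] by simp
  then have F: "(x, y, f) \<in> hom (EM C T) x y"
    using EM f by (simp add: EM_def hom_structured_cat x y)
  then have "Jm (x, y, f) = g"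
    using J_arrows by (auto simp: hom_def g_eq)
  with F show "\<exists>f\<in>hom (EM C T) x y. Jm f = g" by blast
qed

lemma faithful_J: "faithful_functor (EM C T) Jm"
proof -
  have "f = g" if hom: "f \<in> hom (EM C T) x y" "g \<in> hom (EM C T) x y" and eq: "Jm f = Jm g" for f g x y
  proof -
    obtain f' g' where fg: "f = (x, y, f')" "g = (x, y, g')"
      using hom by (auto simp: EM_def hom_structured_cat)
    then have "Jm f = (Jo x, Jo y, f')" "Jm g = (Jo x, Jo y, g')"
      using J_arrows hom by (auto simp: hom_def)
    with fg eq show ?thesis by simp
  qed
  then show ?thesis by (auto simp: faithful_functor_def inj_on_def)
qed

end

end

theorem theorem5p4:
  fixes C :: "('o, 'm) coprod_cat" and T :: "('o, 'm) kleisli"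
  assumes "category C" and "finite_coproducts C" and "kleisli_triple C T"
  shows "(\<forall>dag. weak_complete_elgot_monad C T dag \<longrightarrow>
      isomorphic_categories (EM C T)
        (full_subcategory (CElg C T)
          {(A, a, sol). complete_elgot_algebra C T A a sol \<and>
             (\<exists>b\<in>hom C (TO T A) A. a = b \<cdot>\<^bsub>C\<^esub> Tmap C T (codiag C A)) \<and>
             (\<forall>X\<in>Obj C. \<forall>e\<in>hom C X (TO T (A \<oplus>\<^bsub>C\<^esub> X)).
                sol e = a \<cdot>\<^bsub>C\<^esub> Tmap C T (inl C A A) \<cdot>\<^bsub>C\<^esub> dag A e)}))
    \<and> (\<forall>Jo Jm. cat_functor (EM C T) (CElg C T) Jo Jm
        \<and> (\<forall>(A, a)\<in>Obj (EM C T). \<exists>sol. Jo (A, a) = (A, a \<cdot>\<^bsub>C\<^esub> Tmap C T (codiag C A), sol))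
        \<and> (\<forall>(x, y, f)\<in>Arr (EM C T). Jm (x, y, f) = (Jo x, Jo y, f))
        \<longrightarrow> weak_complete_elgot_monad C T
              (\<lambda>Y e. case Jo (TO T Y, mu C T Y) of (_, _, sol) \<Rightarrow>
                 sol (Tmap C T (sum_arr C (eta T Y) (Id C (Dom C e))) \<cdot>\<^bsub>C\<^esub> e))
            \<and> full_functor (EM C T) (CElg C T) Jo Jm
            \<and> faithful_functor (EM C T) Jm)"
proof -
  interpret kleisli_coproducts C T
    using assms by (intro kleisli_coproducts.intro)
  show ?thesis
    using EM_isomorphic_elgot_algebras weak_complete_elgot_monad_J full_J faithful_J
    by blast
qed

end
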